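(* Let $R$ be an algebraically closed field of characteristic $\ell\ge 0$ different from $p$, and let $(\pi,V)$ be an irreducible $R$-representation of $G=\mathrm{GL}_n(\mathbf{k})$. (1) Then $\pi$ satisfies $\mathbf{WGJFE}$. (2) If, moreover, either the cuspidal support of $\pi$ does not contain the trivial character of $\mathbf{k}^\times=\mathrm{GL}_1(\mathbf{k})$, or $\ell\neq0$ and $\ell\mid q-1$, then $\pi$ satisfies $\mathbf{GJFE}$.
   Context: $\mathbf{k}$ is a finite field of characteristic $p$ and cardinality $q$. A square root $q^{1/2}$ of $q$ in $R$ is fixed and $|M_n(\mathbf{k})|^{1/2}:=(q^{1/2})^{n^2}$. For a non-trivial character $\psi:\mathbf{k}\to R^\times$ and a function $\Phi:M_n(\mathbf{k})\to R$, $\widehat\Phi(a)=|M_n(\mathbf{k})|^{-1/2}\sum_{g\in M_n(\mathbf{k})}\Phi(g)\psi(\mathrm{tr}(ga))$. With $V^\vee=\mathrm{Hom}_R(V,R)$, $\pi$ satisfies $\mathbf{GJFE}$ (resp. $\mathbf{WGJFE}$) if for every non-trivial character $\psi:\mathbf{k}\to R^\times$ there is $\gamma(\pi,\psi)\in R$ such that $$\sum_{g\in G}\widehat\Phi(g)v^\vee(\pi(g^{-1})v)=\gamma(\pi,\psi)\sum_{g\in G}\Phi(g)v^\vee(\pi(g)v)$$ for all $v\in V$, $v^\vee\in V^\vee$ and all functions $\Phi:M_n(\mathbf{k})\to R$ (resp. all such $\Phi$ supported on $G$). A representation of $\mathrm{GL}_m(\mathbf{k})$ is cuspidal if its coinvariants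 under the unipotent radical of every proper parabolic subgroup vanish (so all characters of $\mathrm{GL}_1(\mathbf{k})$ are cuspidal). The cuspidal support of $\pi$ is the unique multiset $\{\rho_1,\dots,\rho_r\}$ of (isomorphism classes of) irreducible cuspidal representations of groups $\mathrm{GL}_{n_i}(\mathbf{k})$, $\sum n_i=n$, such that, for some ordering, $\pi$ is a quotient of the representation $\rho_1\times\cdots\times\rho_r$ parabolically induced from the block upper triangular parabolic subgroup with Levi factor $\prod_i\mathrm{GL}_{n_i}(\mathbf{k})$. *)

theory Defs
  imports
    "Jordan_Normal_Form.Matrix"
    "HOL-Library.Function_Algebras"
    "HOL-Library.Multiset"
    "HOL-Library.Cardinality"
    "HOL-Computational_Algebra.Computational_Algebra"
begin

section \<open>Representations on subspaces of a vector space\<close>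

definition linear_on ::
  "('r::field \<Rightarrow> 'v::ab_group_add \<Rightarrow> 'v) \<Rightarrow> 'v set \<Rightarrow>
   ('r \<Rightarrow> 'w::ab_group_add \<Rightarrow> 'w) \<Rightarrow> 'w set \<Rightarrow> ('v \<Rightarrow> 'w) \<Rightarrow> bool" where
  "linear_on s V t W f \<longleftrightarrow>
     f ` V \<subseteq> W \<and>
     (\<forall>v\<in>V. \<forall>w\<in>V. f (v + w) = f v + f w) \<and>
     (\<forall>c. \<forall>v\<in>V. f (s c v) = t c (f v))"

text \<open>A representation of \<open>G\<close> on the subspace \<open>V\<close> of the vector space with scalar
  multiplication \<open>s\<close>. Nothing is required of \<open>\<pi>\<close> outside \<open>carrier G\<close> and \<open>V\<close>.\<close>

definition is_representation ::
  "('g, 'b) monoid_scheme \<Rightarrow> ('r::field \<Rightarrow> 'v::ab_group_add \<Rightarrow> 'v) \<Rightarrow> 'v set \<Rightarrow>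
   ('g \<Rightarrow> 'v \<Rightarrow> 'v) \<Rightarrow> bool" where
  "is_representation G s V \<pi> \<longleftrightarrow>
     vector_space s \<and> module.subspace s V \<and>
     (\<forall>g\<in>carrier G. linear_on s V s V (\<pi> g)) \<and>
     (\<forall>v\<in>V. \<pi> \<one>\<^bsub>G\<^esub> v = v) \<and>
     (\<forall>g\<in>carrier G. \<forall>h\<in>carrier G. \<forall>v\<in>V. \<pi> (g \<otimes>\<^bsub>G\<^esub> h) v = \<pi> g (\<pi> h v))"

definition irreducible_rep ::
  "('g, 'b) monoid_scheme \<Rightarrow> ('r::field \<Rightarrow> 'v::ab_group_add \<Rightarrow> 'v) \<Rightarrow> 'v set \<Rightarrow>
   ('g \<Rightarrow> 'v \<Rightarrow> 'v) \<Rightarrow> bool" where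
  "irreducible_rep G s V \<pi> \<longleftrightarrow>
     is_representation G s V \<pi> \<and> V \<noteq> {0} \<and>
     (\<forall>W. W \<subseteq> V \<and> module.subspace s W \<and> (\<forall>g\<in>carrier G. \<pi> g ` W \<subseteq> W)
          \<longrightarrow> W = {0} \<or> W = V)"

definition intertwiner ::
  "('g, 'b) monoid_scheme \<Rightarrow>
   ('r::field \<Rightarrow> 'v::ab_group_add \<Rightarrow> 'v) \<Rightarrow> 'v set \<Rightarrow> ('g \<Rightarrow> 'v \<Rightarrow> 'v) \<Rightarrow>
   ('r \<Rightarrow> 'w::ab_group_add \<Rightarrow> 'w) \<Rightarrow> 'w set \<Rightarrow> ('g \<Rightarrow> 'w \<Rightarrow> 'w) \<Rightarrow>
   ('v \<Rightarrow> 'w) \<Rightarrow> bool" where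
  "intertwiner G s V \<pi> t W \<rho> f \<longleftrightarrow>
     linear_on s V t W f \<and> (\<forall>g\<in>carrier G. \<forall>v\<in>V. f (\<pi> g v) = \<rho> g (f v))"

text \<open>The space of coinvariants of \<open>V\<close> under \<open>H\<close> is the quotient of \<open>V\<close> by
  \<open>coinvariant_kernel s V \<pi> H\<close>; it vanishes iff this subspace is all of \<open>V\<close>.\<close>

definition coinvariant_kernel ::
  "('r::field \<Rightarrow> 'v::ab_group_add \<Rightarrow> 'v) \<Rightarrow> 'v set \<Rightarrow> ('g \<Rightarrow> 'v \<Rightarrow> 'v) \<Rightarrow> 'g set \<Rightarrow> 'v set" where
  "coinvariant_kernel s V \<pi> H = module.span s {\<pi> h v - v | h v. h \<in> H \<and> v \<in> V}"


section \<open>General linear groups and their parabolic subgroups\<close>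

definition GL :: "nat \<Rightarrow> 'k::field mat monoid" where
  "GL n = units_of (ring_mat TYPE('k) n ())"

definition composition :: "nat \<Rightarrow> nat list \<Rightarrow> bool" where
  "composition n ms \<longleftrightarrow> (\<forall>m\<in>set ms. 0 < m) \<and> sum_list ms = n"

text \<open>Block \<open>j\<close> of the composition \<open>ms\<close> consists of the indices from \<open>offset ms j\<close>
  (inclusive) to \<open>offset ms (Suc j)\<close> (exclusive).\<close>

definition offset :: "nat list \<Rightarrow> nat \<Rightarrow> nat" where
  "offset ms j = sum_list (take j ms)"

definition diag_block :: "nat list \<Rightarrow> nat \<Rightarrow> 'k mat \<Rightarrow> 'k mat" where
  "diag_block ms j g =
     mat (ms ! j) (ms ! j) (\<lambda>(a, b). g $$ (offset ms j + a, offset ms j + b))"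

definition std_parabolic :: "nat list \<Rightarrow> 'k::field mat set" where
  "std_parabolic ms = {g \<in> carrier (GL (sum_list ms)).
     \<forall>j<length ms. \<forall>a b. offset ms j \<le> a \<and> a < sum_list ms \<and> b < offset ms j
        \<longrightarrow> g $$ (a, b) = 0}"

definition std_unipotent_radical :: "nat list \<Rightarrow> 'k::field mat set" where
  "std_unipotent_radical ms =
     {u \<in> std_parabolic ms. \<forall>j<length ms. diag_block ms j u = 1\<^sub>m (ms ! j)}"

text \<open>The parabolic subgroups of \<open>GL n\<close> are the conjugates of the block upper triangular
  ones; such a subgroup is proper iff there are at least two blocks.\<close>

definition proper_unipotent_radicals :: "nat \<Rightarrow> 'k::field mat set set" where
  "proper_unipotent_radicals n =
     {(\<lambda>u. g \<otimes>\<^bsub>GL n\<^esub> u \<otimes>\<^bsub>GL n\<^esub> inv\<^bsub>GL n\<^esub> g) ` std_unipotent_radical ms | ms g.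
        composition n ms \<and> 2 \<le> length ms \<and> g \<in> carrier (GL n)}"

definition cuspidal ::
  "nat \<Rightarrow> ('r::field \<Rightarrow> 'v::ab_group_add \<Rightarrow> 'v) \<Rightarrow> 'v set \<Rightarrow> ('k::field mat \<Rightarrow> 'v \<Rightarrow> 'v) \<Rightarrow> bool" where
  "cuspidal n s V \<pi> \<longleftrightarrow> (\<forall>U\<in>proper_unipotent_radicals n. coinvariant_kernel s V \<pi> U = V)"


section \<open>Finite-dimensional representations in coordinates\<close>

text \<open>\<open>coords I\<close> is the coordinate space with index set \<open>I\<close>, realised as the functions
  that vanish outside \<open>I\<close>.\<close>

definition coords :: "'i set \<Rightarrow> ('i \<Rightarrow> 'r::zero) set" where
  "coords I = {v. \<forall>i. i \<notin> I \<longrightarrow> v i = 0}"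

definition fun_scale :: "'r::times \<Rightarrow> ('i \<Rightarrow> 'r) \<Rightarrow> 'i \<Rightarrow> 'r" where
  "fun_scale c v = (\<lambda>i. c * v i)"

text \<open>The members of a cuspidal support are representations of groups \<open>GL m\<close> of varying rank
  \<open>m\<close> on spaces of varying dimension \<open>d\<close>. To have them all in one type, \<open>GLRep m d \<rho>\<close> has
  the underlying space \<open>coords {..<d}\<close>. Irreducible representations of finite groups are
  finite-dimensional, so every isomorphism class of them is represented.\<close>

datatype ('k, 'r) glrep =
  GLRep (rk: nat) (dm: nat) (act: "'k mat \<Rightarrow> (nat \<Rightarrow> 'r) \<Rightarrow> (nat \<Rightarrow> 'r)")

definition rep_space :: "('k, 'r::field) glrep \<Rightarrow> (nat \<Rightarrow> 'r) set" where
  "rep_space \<rho> = coords {..<dm \<rho>}"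

definition iso_class :: "('k::field, 'r::field) glrep \<Rightarrow> ('k, 'r) glrep set" where
  "iso_class \<rho> = {\<sigma>. rk \<sigma> = rk \<rho> \<and>
     is_representation (GL (rk \<sigma>)) fun_scale (rep_space \<sigma>) (act \<sigma>) \<and>
     (\<exists>f. intertwiner (GL (rk \<rho>)) fun_scale (rep_space \<rho>) (act \<rho>) fun_scale (rep_space \<sigma>) (act \<sigma>) f
          \<and> bij_betw f (rep_space \<rho>) (rep_space \<sigma>))}"

definition trivial_GL1 :: "('k::field, 'r::field) glrep" where
  "trivial_GL1 = GLRep 1 1 (\<lambda>g v. v)"


section \<open>Parabolic induction and cuspidal support\<close>

text \<open>The tensor product of the coordinate spaces of dimensions \<open>ds\<close> is the coordinate space
  indexed by \<open>multi_indices ds\<close>; the matrix of a tensor product of operators is the Kronecker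
  product of their matrices.\<close>

definition multi_indices :: "nat list \<Rightarrow> nat list set" where
  "multi_indices ds = {is. length is = length ds \<and> (\<forall>k<length ds. is ! k < ds ! k)}"

definition entry :: "((nat \<Rightarrow> 'r) \<Rightarrow> (nat \<Rightarrow> 'r)) \<Rightarrow> nat \<Rightarrow> nat \<Rightarrow> 'r::field" where
  "entry A i j = A (\<lambda>k. if k = j then 1 else 0) i"

definition tensor_op ::
  "nat list \<Rightarrow> (nat \<Rightarrow> (nat \<Rightarrow> 'r) \<Rightarrow> (nat \<Rightarrow> 'r)) \<Rightarrow> (nat list \<Rightarrow> 'r) \<Rightarrow> (nat list \<Rightarrow> 'r::field)" where
  "tensor_op ds A T = (\<lambda>is. if is \<in> multi_indices ds
     then \<Sum>js\<in>multi_indices ds. (\<Prod>k<length ds. entry (A k) (is ! k) (js ! k)) * T js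
     else 0)"

text \<open>The tensor product of the \<open>\<rho>s\<close>, inflated from the Levi factor to the parabolic
  subgroup.\<close>

definition inflated_act ::
  "('k, 'r::field) glrep list \<Rightarrow> 'k mat \<Rightarrow> (nat list \<Rightarrow> 'r) \<Rightarrow> (nat list \<Rightarrow> 'r)" where
  "inflated_act \<rho>s p =
     tensor_op (map dm \<rho>s) (\<lambda>k. act (\<rho>s ! k) (diag_block (map rk \<rho>s) k p))"

text \<open>The representation parabolically induced from the tensor product of the \<open>\<rho>s\<close>: functions
  on the group that are equivariant under left translation by the parabolic subgroup
  (extended by zero to all matrices), with the group acting by right translation.\<close>

definition induced_space ::
  "('k::field, 'r::field) glrep list \<Rightarrow> ('k mat \<Rightarrow> nat list \<Rightarrow> 'r) set" where
  "induced_space \<rho>s = {f.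
     (\<forall>x. x \<notin> carrier (GL (sum_list (map rk \<rho>s))) \<longrightarrow> f x = 0) \<and>
     (\<forall>x. f x \<in> coords (multi_indices (map dm \<rho>s))) \<and>
     (\<forall>p\<in>std_parabolic (map rk \<rho>s). \<forall>x\<in>carrier (GL (sum_list (map rk \<rho>s))).
        f (p * x) = inflated_act \<rho>s p (f x))}"

definition induced_act ::
  "('k::field, 'r::field) glrep list \<Rightarrow> 'k mat \<Rightarrow>
   ('k mat \<Rightarrow> nat list \<Rightarrow> 'r) \<Rightarrow> ('k mat \<Rightarrow> nat list \<Rightarrow> 'r)" where
  "induced_act \<rho>s g f =
     (\<lambda>x. if x \<in> carrier (GL (sum_list (map rk \<rho>s))) then f (x * g) else 0)"

definition induced_scale :: "'r::field \<Rightarrow> ('x \<Rightarrow> 'i \<Rightarrow> 'r) \<Rightarrow> ('x \<Rightarrow> 'i \<Rightarrow> 'r)" where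
  "induced_scale c f = (\<lambda>x. fun_scale c (f x))"

text \<open>\<open>M\<close> is the cuspidal support of the irreducible representation \<open>\<pi>\<close> of \<open>GL n\<close>: a multiset
  of isomorphism classes of irreducible cuspidal representations such that, for some ordering
  \<open>\<rho>s\<close> of it, \<open>\<pi>\<close> is a quotient of the parabolically induced representation. That exactly
  one such \<open>M\<close> exists is a theorem, so this is stated as a relation rather than a function.\<close>

definition is_cuspidal_support ::
  "nat \<Rightarrow> ('r::field \<Rightarrow> 'v::ab_group_add \<Rightarrow> 'v) \<Rightarrow> 'v set \<Rightarrow> ('k::field mat \<Rightarrow> 'v \<Rightarrow> 'v) \<Rightarrow>
   ('k, 'r) glrep set multiset \<Rightarrow> bool" where
  "is_cuspidal_support n s V \<pi> M \<longleftrightarrow>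
     (\<exists>\<rho>s. M = mset (map iso_class \<rho>s) \<and>
        composition n (map rk \<rho>s) \<and>
        (\<forall>\<rho>\<in>set \<rho>s. irreducible_rep (GL (rk \<rho>)) fun_scale (rep_space \<rho>) (act \<rho>) \<and>
                    cuspidal (rk \<rho>) fun_scale (rep_space \<rho>) (act \<rho>)) \<and>
        (\<exists>F. intertwiner (GL n) induced_scale (induced_space \<rho>s) (induced_act \<rho>s) s V \<pi> F \<and>
             F ` induced_space \<rho>s = V))"


section \<open>Fourier transform and functional equations\<close>

definition nontrivial_character :: "('k::field \<Rightarrow> 'r::field) \<Rightarrow> bool" where
  "nontrivial_character \<psi> \<longleftrightarrow>
     (\<forall>x. \<psi> x \<noteq> 0) \<and> (\<forall>x y. \<psi> (x + y) = \<psi> x * \<psi> y) \<and> (\<exists>x. \<psi> x \<noteq> 1)"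

definition mtrace :: "'k::comm_monoid_add mat \<Rightarrow> 'k" where
  "mtrace A = (\<Sum>i<dim_row A. A $$ (i, i))"

text \<open>Throughout, \<open>r\<close> is the chosen square root of the cardinality of \<open>'k\<close>, and a function on
  square matrices of size \<open>n\<close> is given by a function on \<open>'k mat\<close>, of which only the values
  on \<open>carrier_mat n n\<close> matter.\<close>

definition fourier ::
  "'r::field \<Rightarrow> nat \<Rightarrow> ('k::{field,finite} \<Rightarrow> 'r) \<Rightarrow> ('k mat \<Rightarrow> 'r) \<Rightarrow> 'k mat \<Rightarrow> 'r" where
  "fourier r n \<psi> \<Phi> a =
     inverse (r ^ (n\<^sup>2)) * (\<Sum>g\<in>carrier_mat n n. \<Phi> g * \<psi> (mtrace (g * a)))"

definition functional_equation ::
  "'r::field \<Rightarrow> nat \<Rightarrow> ('r \<Rightarrow> 'v::ab_group_add \<Rightarrow> 'v) \<Rightarrow> ('k::{field,finite} mat \<Rightarrow> 'v \<Rightarrow> 'v) \<Rightarrow>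
   ('k \<Rightarrow> 'r) \<Rightarrow> 'r \<Rightarrow> ('k mat \<Rightarrow> 'r) \<Rightarrow> bool" where
  "functional_equation r n s \<pi> \<psi> \<gamma> \<Phi> \<longleftrightarrow>
     (\<forall>v v'. Vector_Spaces.linear s (*) v' \<longrightarrow>
        (\<Sum>g\<in>carrier (GL n). fourier r n \<psi> \<Phi> g * v' (\<pi> (inv\<^bsub>GL n\<^esub> g) v)) =
        \<gamma> * (\<Sum>g\<in>carrier (GL n). \<Phi> g * v' (\<pi> g v)))"

definition GJFE ::
  "'r::field \<Rightarrow> nat \<Rightarrow> ('r \<Rightarrow> 'v::ab_group_add \<Rightarrow> 'v) \<Rightarrow> ('k::{field,finite} mat \<Rightarrow> 'v \<Rightarrow> 'v) \<Rightarrow> bool" where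
  "GJFE r n s \<pi> \<longleftrightarrow>
     (\<forall>\<psi>. nontrivial_character \<psi> \<longrightarrow> (\<exists>\<gamma>. \<forall>\<Phi>. functional_equation r n s \<pi> \<psi> \<gamma> \<Phi>))"

definition WGJFE ::
  "'r::field \<Rightarrow> nat \<Rightarrow> ('r \<Rightarrow> 'v::ab_group_add \<Rightarrow> 'v) \<Rightarrow> ('k::{field,finite} mat \<Rightarrow> 'v \<Rightarrow> 'v) \<Rightarrow> bool" where
  "WGJFE r n s \<pi> \<longleftrightarrow>
     (\<forall>\<psi>. nontrivial_character \<psi> \<longrightarrow>
        (\<exists>\<gamma>. \<forall>\<Phi>. (\<forall>g\<in>carrier_mat n n - carrier (GL n). \<Phi> g = 0) \<longrightarrow>
              functional_equation r n s \<pi> \<psi> \<gamma> \<Phi>))"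

end

theory Submission
  imports Defs "Jordan_Normal_Form.Determinant"
begin

text \<open>
  Let \<open>F a = (\<Sum>g\<in>GL n. \<psi> (tr (a g)) \<pi> (g\<inverse>))\<close> for a matrix \<open>a\<close>. For invertible \<open>a\<close> one has
  \<open>F a = F 1 \<circ> \<pi> a\<close>, and \<open>F 1\<close> is a scalar by Schur's lemma. Testing the functional
  equation on delta functions, this is the weak functional equation, and the full one holds as soon
  as \<open>F a = 0\<close> for all singular \<open>a\<close>.

  Multiplication by unipotent matrices shows that only those \<open>g\<close> for which \<open>a g\<close> is block upper
  triangular contribute to the sum on functions invariant under a unipotent radical; then some
  diagonal block of \<open>a g\<close> is singular, so the vanishing for the diagonal blocks implies the
  vanishing on a parabolically induced representation and on its quotients. All sums are killed
  along orbits of subgroups, so that no group order has to be inverted in the coefficient field.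

  For a cuspidal representation of rank at least 2, \<open>F a\<close> with \<open>a\<close> singular is invariant under
  a unipotent radical and thus factors through zero coinvariants; in rank 1, \<open>F 0\<close> is the sum of
  all values of a character, hence vanishes for a nontrivial one. If \<open>q - 1\<close> is zero in the
  coefficient field, every nonzero representation contains a nonzero vector on which the
  operators with singular \<open>a\<close> vanish, and irreducibility spreads this to all vectors.
\<close>

section \<open>Invertible matrices over a finite field\<close>

lemma carrier_GL: "carrier (GL n) = {g \<in> carrier_mat n n. det g \<noteq> (0::'k::field)}"
proof -
  have "Units (ring_mat TYPE('k) n ()) = {g \<in> carrier_mat n n. det g \<noteq> 0}"
    using unit_imp_det_non_zero[where ?'a = 'k] det_non_zero_imp_unit[where ?'a = 'k]
    by (auto simp: Units_def ring_mat_simps)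
  then show ?thesis
    by (simp add: GL_def units_of_def)
qed

lemma GL_mult [simp]: "g \<otimes>\<^bsub>GL n\<^esub> h = g * h"
  by (simp add: GL_def units_of_def ring_mat_simps)

lemma GL_one [simp]: "\<one>\<^bsub>GL n\<^esub> = 1\<^sub>m n"
  by (simp add: GL_def units_of_def ring_mat_simps)

lemma group_GL: "group (GL n :: 'k::field mat monoid)"
proof -
  interpret ring "ring_mat TYPE('k) n ()" by (rule ring_mat)
  show ?thesis unfolding GL_def by (rule units_group)
qed

lemma GL_carrier_mat: "g \<in> carrier (GL n) \<Longrightarrow> g \<in> carrier_mat n n"
  by (simp add: carrier_GL)

lemma GL_mult_closed: "g \<in> carrier (GL n) \<Longrightarrow> h \<in> carrier (GL n) \<Longrightarrow> g * h \<in> carrier (GL n)"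
  by (auto simp: carrier_GL det_mult)

lemma GL_one_closed: "1\<^sub>m n \<in> carrier (GL n)"
  by (simp add: carrier_GL)

lemma GL_inv_closed: "g \<in> carrier (GL n) \<Longrightarrow> inv\<^bsub>GL n\<^esub> g \<in> carrier (GL n)"
  by (rule group.inv_closed[OF group_GL])

lemma GL_inv_left: "g \<in> carrier (GL n) \<Longrightarrow> inv\<^bsub>GL n\<^esub> g * g = 1\<^sub>m n"
  using group.l_inv[OF group_GL, of g n] by simp

lemma GL_inv_right: "g \<in> carrier (GL n) \<Longrightarrow> g * inv\<^bsub>GL n\<^esub> g = 1\<^sub>m n"
  using group.r_inv[OF group_GL, of g n] by simp

lemma GL_inv_mult: "g \<in> carrier (GL n) \<Longrightarrow> h \<in> carrier (GL n) \<Longrightarrow>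
    inv\<^bsub>GL n\<^esub> (g * h) = inv\<^bsub>GL n\<^esub> h * inv\<^bsub>GL n\<^esub> g"
  using group.inv_mult_group[OF group_GL, of g n h] by simp

lemma GL_inv_inv: "g \<in> carrier (GL n) \<Longrightarrow> inv\<^bsub>GL n\<^esub> (inv\<^bsub>GL n\<^esub> g) = g"
  by (rule group.inv_inv[OF group_GL])

lemma GL_inv_one: "inv\<^bsub>GL n\<^esub> (1\<^sub>m n) = 1\<^sub>m n"
  by (rule group.inv_equality[OF group_GL, unfolded GL_mult GL_one]) (simp_all add: GL_one_closed)

lemma GL_inv_eqI:
  "g * h = 1\<^sub>m n \<Longrightarrow> g \<in> carrier (GL n) \<Longrightarrow> h \<in> carrier (GL n) \<Longrightarrow> inv\<^bsub>GL n\<^esub> h = g"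
  by (rule group.inv_equality[OF group_GL, unfolded GL_mult GL_one])

section \<open>Substitutions in sums over the group, and finiteness\<close>

lemma bij_betw_GL_inv: "bij_betw (\<lambda>g. inv\<^bsub>GL n\<^esub> g) (carrier (GL n)) (carrier (GL n))"
  by (rule bij_betw_byWitness[where f' = "\<lambda>g. inv\<^bsub>GL n\<^esub> g"])
    (auto simp: GL_inv_inv GL_inv_closed)

lemma bij_betw_GL_mult_left:
  assumes "h \<in> carrier (GL n)"
  shows "bij_betw (\<lambda>g. h * g) (carrier (GL n)) (carrier (GL n))"
proof (rule bij_betw_byWitness[where f' = "\<lambda>g. inv\<^bsub>GL n\<^esub> h * g"])
  show "\<forall>g\<in>carrier (GL n). inv\<^bsub>GL n\<^esub> h * (h * g) = g"
    "\<forall>g\<in>carrier (GL n). h * (inv\<^bsub>GL n\<^esub> h * g) = g"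
    using assms GL_inv_closed[OF assms]
    by (auto simp: assoc_mult_mat[symmetric, of _ n n _ n _ n] GL_carrier_mat GL_inv_left GL_inv_right
        left_mult_one_mat[of _ n n] right_mult_one_mat[of _ n n])
qed (use assms in \<open>auto intro!: GL_mult_closed GL_inv_closed\<close>)

lemma bij_betw_GL_mult_right:
  assumes "h \<in> carrier (GL n)"
  shows "bij_betw (\<lambda>g. g * h) (carrier (GL n)) (carrier (GL n))"
proof (rule bij_betw_byWitness[where f' = "\<lambda>g. g * inv\<^bsub>GL n\<^esub> h"])
  show "\<forall>g\<in>carrier (GL n). g * h * inv\<^bsub>GL n\<^esub> h = g"
    "\<forall>g\<in>carrier (GL n). g * inv\<^bsub>GL n\<^esub> h * h = g"
    using assms GL_inv_closed[OF assms]
    by (auto simp: assoc_mult_mat[of _ n n _ n _ n] GL_carrier_mat GL_inv_left GL_inv_right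
        left_mult_one_mat[of _ n n] right_mult_one_mat[of _ n n])
qed (use assms in \<open>auto intro!: GL_mult_closed GL_inv_closed\<close>)

lemma GL_transpose: "g \<in> carrier (GL n) \<Longrightarrow> g\<^sup>T \<in> carrier (GL n)"
  by (auto simp: carrier_GL det_transpose)

lemma bij_betw_GL_transpose: "bij_betw transpose_mat (carrier (GL n)) (carrier (GL n))"
  by (rule bij_betw_byWitness[where f' = transpose_mat]) (auto intro: GL_transpose)

lemma finite_carrier_mat: "finite (carrier_mat m n :: 'k::finite mat set)"
proof (rule finite_subset)
  show "carrier_mat m n \<subseteq> mat m n ` (({..<m} \<times> {..<n}) \<rightarrow>\<^sub>E (UNIV :: 'k set))"
  proof
    fix A :: "'k mat" assume "A \<in> carrier_mat m n"
    then have "A = mat m n (restrict (\<lambda>ij. A $$ ij) ({..<m} \<times> {..<n}))"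
      by (intro eq_matI) auto
    then show "A \<in> mat m n ` (({..<m} \<times> {..<n}) \<rightarrow>\<^sub>E (UNIV :: 'k set))"
      by (metis (no_types, lifting) PiE_I imageI iso_tuple_UNIV_I restrict_apply)
  qed
qed (intro finite_imageI finite_PiE; simp)

lemma finite_GL: "finite (carrier (GL n) :: 'k::{field,finite} mat set)"
  by (rule finite_subset[OF _ finite_carrier_mat]) (auto simp: carrier_GL)

text \<open>Row reduction of \<open>a\<^sup>T\<close> produces a zero last row; a swap puts it
  first, and transposing back turns the row operations into the column operation \<open>k\<close>.
  Later the zero column has to be the first one, so that it meets the first row of another factor.
  \<open>0 < n\<close> holds because the empty matrix has determinant 1.\<close>

lemma singular_matrix_col_0:
  assumes a: "a \<in> carrier_mat n n" and "det a = (0::'k::field)"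
  shows "0 < n \<and> (\<exists>k\<in>carrier (GL n). \<forall>i<n. (a * k) $$ (i, 0) = 0)"
proof -
  have at: "a\<^sup>T \<in> carrier_mat n n" "det a\<^sup>T = 0"
    using assms by (auto simp: det_transpose)
  obtain P where P: "P \<in> Units (ring_mat TYPE('k) n ())" and row: "row (P * a\<^sup>T) (n - 1) = 0\<^sub>v n"
    and n: "0 < n"
    using det_zero_imp_zero_row[OF at, of "()"] by blast
  have P': "P \<in> carrier (GL n)"
    using P by (simp add: GL_def units_of_def)
  have S: "swaprows_mat n 0 (n - 1) \<in> carrier (GL n :: 'k mat monoid)"
    using swaprows_mat_Unit[of 0 n "n - 1", where ?'a = 'k] n by (simp add: GL_def units_of_def)
  define k where "k = (swaprows_mat n 0 (n - 1) * P)\<^sup>T"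
  have k: "k \<in> carrier (GL n)"
    unfolding k_def by (intro GL_transpose GL_mult_closed S P')
  have "(a * k) $$ (i, 0) = 0" if i: "i < n" for i
  proof -
    have "a * k = (swaprows_mat n 0 (n - 1) * P * a\<^sup>T)\<^sup>T"
      using a GL_carrier_mat[OF P'] GL_carrier_mat[OF S] unfolding k_def
      by (subst transpose_mult[of "swaprows_mat n 0 (n - 1) * P" n n "a\<^sup>T" n]) auto
    also have "swaprows_mat n 0 (n - 1) * P * a\<^sup>T = swaprows 0 (n - 1) (P * a\<^sup>T)"
      using a GL_carrier_mat[OF P'] n
      by (subst swaprows_mat[of _ n n]) (auto simp: assoc_mult_mat[of _ n n _ n _ n])
    finally have "(a * k) $$ (i, 0) = (P * a\<^sup>T) $$ (n - 1, i)"
      using i n a GL_carrier_mat[OF P'] by auto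
    also have "\<dots> = row (P * a\<^sup>T) (n - 1) $ i"
      using i n a GL_carrier_mat[OF P'] by simp
    finally show ?thesis using row i by simp
  qed
  with n k show ?thesis by blast
qed

section \<open>Block matrices\<close>

text \<open>The unipotent radical of the two-block parabolic subgroup; \<open>bdiag\<close> below
  gives its Levi factor.\<close>

definition unip :: "nat \<Rightarrow> nat \<Rightarrow> 'k::field mat \<Rightarrow> 'k mat" where
  "unip m l X = four_block_mat (1\<^sub>m m) X (0\<^sub>m l m) (1\<^sub>m l)"

definition bdiag :: "'k::field mat \<Rightarrow> 'k mat \<Rightarrow> 'k mat" where
  "bdiag A D = four_block_mat A (0\<^sub>m (dim_row A) (dim_col D)) (0\<^sub>m (dim_row D) (dim_col A)) D"

lemma unip_carrier: "unip m l X \<in> carrier_mat (m + l) (m + l)"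
  by (simp add: unip_def)

lemma bdiag_carrier:
  "A \<in> carrier_mat m m \<Longrightarrow> D \<in> carrier_mat l l \<Longrightarrow> bdiag A D \<in> carrier_mat (m + l) (m + l)"
  by (auto simp: bdiag_def)

lemma unip_GL: "X \<in> carrier_mat m l \<Longrightarrow> unip m l X \<in> carrier (GL (m + l))"
  by (simp add: carrier_GL unip_carrier)
    (simp add: unip_def det_four_block_mat_lower_left_zero[of _ m _ l])

lemma bdiag_GL:
  "A \<in> carrier (GL m) \<Longrightarrow> D \<in> carrier (GL l) \<Longrightarrow> bdiag A D \<in> carrier (GL (m + l))"
  by (auto simp: carrier_GL bdiag_carrier bdiag_def det_four_block_mat_lower_left_zero[of _ m _ l])

lemma unip_mult:
  assumes "X \<in> carrier_mat m l" "Y \<in> carrier_mat m l"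
  shows "unip m l X * unip m l Y = unip m l (X + Y)"
  unfolding unip_def using assms
  by (subst mult_four_block_mat[of _ m m _ l _ l _ _ m _ l]) (auto simp: comm_add_mat)

lemma bdiag_mult:
  assumes "A \<in> carrier_mat m m" "A' \<in> carrier_mat m m" "D \<in> carrier_mat l l" "D' \<in> carrier_mat l l"
  shows "bdiag A D * bdiag A' D' = bdiag (A * A') (D * D')"
  unfolding bdiag_def using assms
  by (subst mult_four_block_mat[of _ m m _ l _ l _ _ m _ l]) auto

lemma bdiag_one: "bdiag (1\<^sub>m m) (1\<^sub>m l) = 1\<^sub>m (m + l)"
  by (simp add: bdiag_def)

lemma unip_zero: "unip m l (0\<^sub>m m l) = 1\<^sub>m (m + l)"
  by (simp add: unip_def)

lemma unip_inv:
  assumes "X \<in> carrier_mat m l"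
  shows "inv\<^bsub>GL (m + l)\<^esub> (unip m l X) = unip m l (- X)"
  using assms by (intro GL_inv_eqI unip_GL) (auto simp: unip_mult unip_zero)

lemma bdiag_inv:
  assumes "A \<in> carrier (GL m)" "D \<in> carrier (GL l)"
  shows "inv\<^bsub>GL (m + l)\<^esub> (bdiag A D) = bdiag (inv\<^bsub>GL m\<^esub> A) (inv\<^bsub>GL l\<^esub> D)"
  using assms
  by (intro GL_inv_eqI bdiag_GL GL_inv_closed)
    (auto simp: bdiag_mult[of _ m _ _ l] bdiag_one GL_inv_left GL_carrier_mat GL_inv_closed)

text \<open>The block \<open>D\<close> normalises the unipotent radical, hence preserves the vectors
  fixed by that radical.\<close>

lemma unip_bdiag_commute:
  assumes "X \<in> carrier_mat m l" "D \<in> carrier_mat l l"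
  shows "unip m l X * bdiag (1\<^sub>m m) D = bdiag (1\<^sub>m m) D * unip m l (X * D)"
  unfolding unip_def bdiag_def using assms
  by (subst (1 2) mult_four_block_mat[of _ m m _ l _ l _ _ m _ l]) auto

lemma bdiag_commute:
  assumes "A \<in> carrier_mat m m" "D \<in> carrier_mat l l"
  shows "bdiag A (1\<^sub>m l) * bdiag (1\<^sub>m m) D = bdiag (1\<^sub>m m) D * bdiag A (1\<^sub>m l)"
  using assms by (simp add: bdiag_mult[of _ m _ _ l])

section \<open>Traces and block decompositions\<close>

lemma mtrace_comm:
  assumes "A \<in> carrier_mat m l" "B \<in> carrier_mat l m"
  shows "mtrace (A * B) = mtrace (B * (A :: 'k::comm_semiring_0 mat))"
proof -
  have "mtrace (A * B) = (\<Sum>i<m. \<Sum>j<l. A $$ (i, j) * B $$ (j, i))"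
    using assms by (auto simp: mtrace_def scalar_prod_def atLeast0LessThan intro!: sum.cong)
  also have "\<dots> = (\<Sum>j<l. \<Sum>i<m. B $$ (j, i) * A $$ (i, j))"
    by (subst sum.swap) (simp add: mult.commute)
  also have "\<dots> = mtrace (B * A)"
    using assms by (auto simp: mtrace_def scalar_prod_def atLeast0LessThan intro!: sum.cong)
  finally show ?thesis .
qed

lemma mtrace_add:
  "A \<in> carrier_mat m m \<Longrightarrow> B \<in> carrier_mat m m \<Longrightarrow> mtrace (A + B) = mtrace A + mtrace B"
  by (auto simp: mtrace_def sum.distrib)

lemma mtrace_transpose: "A \<in> carrier_mat m m \<Longrightarrow> mtrace (A\<^sup>T) = mtrace A"
  by (auto simp: mtrace_def)

lemma mtrace_four_block:
  assumes "A \<in> carrier_mat m m" "D \<in> carrier_mat l l"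
  shows "mtrace (four_block_mat A B C D) = mtrace A + mtrace D"
proof -
  have "mtrace (four_block_mat A B C D) =
    (\<Sum>i\<in>{..<m + l}. if i < m then A $$ (i, i) else D $$ (i - m, i - m))"
    using assms by (auto simp: mtrace_def intro!: sum.cong)
  also have "\<dots> = (\<Sum>i<m. A $$ (i, i)) + (\<Sum>i<l. D $$ (i, i))"
    by (induction l) (auto simp: add.assoc)
  finally show ?thesis using assms by (simp add: mtrace_def)
qed

lemma four_block_decomp:
  assumes "c \<in> carrier_mat (m + l) (m + l)"
  obtains A B C D where "A \<in> carrier_mat m m" "B \<in> carrier_mat m l" "C \<in> carrier_mat l m"
    "D \<in> carrier_mat l l" "c = four_block_mat A B C D"
proof -
  obtain A B C D where s: "split_block c m m = (A, B, C, D)"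
    by (metis prod_cases4)
  from split_block[OF s, of l l] assms that show ?thesis by auto
qed

section \<open>Sums against an additive character\<close>

text \<open>\<open>A\<close> is a disjoint union of cosets \<open>g H\<close>, where
  \<open>e\<close> enumerates the subgroup \<open>H\<close> without repetition. One coset is removed
  at a time. Summing over the cosets themselves, rather than averaging over \<open>H\<close>, avoids
  dividing by the order of \<open>H\<close>.\<close>

lemma sum_eq_0_by_orbits:
  fixes \<phi> :: "'g \<Rightarrow> 'v::ab_group_add"
  assumes G: "group G" and H: "subgroup (e ` I) G" and inj: "inj_on e I"
    and "finite A" and "A \<subseteq> carrier G"
    and "\<And>g i. g \<in> A \<Longrightarrow> i \<in> I \<Longrightarrow> g \<otimes>\<^bsub>G\<^esub> e i \<in> A"
    and "\<And>g. g \<in> A \<Longrightarrow> (\<Sum>i\<in>I. \<phi> (g \<otimes>\<^bsub>G\<^esub> e i)) = 0"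
  shows "(\<Sum>g\<in>A. \<phi> g) = 0"
  using assms(4-)
proof (induction A rule: finite_psubset_induct)
  case (psubset A)
  show ?case
  proof (cases "A = {}")
    case False
    then obtain g where g: "g \<in> A" by blast
    interpret group G by (rule G)
    interpret H: subgroup "e ` I" G by (rule H)
    have gG: "g \<in> carrier G" using g psubset.prems(1) by blast
    define Orb where "Orb = (\<lambda>i. g \<otimes>\<^bsub>G\<^esub> e i) ` I"
    have Orb: "Orb \<subseteq> A" using psubset.prems(2)[OF g] by (auto simp: Orb_def)
    have gO: "g \<in> Orb"
    proof -
      obtain i where "i \<in> I" "e i = \<one>\<^bsub>G\<^esub>" using H.one_closed by (metis imageE)
      then show ?thesis using gG unfolding Orb_def by (intro image_eqI[of _ _ i]) auto
    qed
    have inj': "inj_on (\<lambda>i. g \<otimes>\<^bsub>G\<^esub> e i) I"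
    proof (rule inj_onI)
      fix i j assume ij: "i \<in> I" "j \<in> I" "g \<otimes>\<^bsub>G\<^esub> e i = g \<otimes>\<^bsub>G\<^esub> e j"
      then have "e i = e j" using gG H.subset by (auto simp: image_subset_iff)
      with ij inj show "i = j" by (auto dest: inj_onD)
    qed
    have "(\<Sum>x\<in>Orb. \<phi> x) = 0"
      unfolding Orb_def using psubset.prems(3)[OF g] by (simp add: sum.reindex[OF inj'])
    moreover have "(\<Sum>x\<in>A - Orb. \<phi> x) = 0"
    proof (rule psubset.IH)
      show "A - Orb \<subset> A" using gO g by blast
      show "A - Orb \<subseteq> carrier G" using psubset.prems(1) by blast
      show "x \<otimes>\<^bsub>G\<^esub> e i \<in> A - Orb" if x: "x \<in> A - Orb" and i: "i \<in> I" for x i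
      proof -
        \<comment> \<open>The complement of an orbit is stable: if \<open>x\<close> times a subgroup
          element lies in the orbit of \<open>g\<close>, cancelling that element puts
          \<open>x\<close> there too.\<close>
        have "x \<in> Orb" if xO: "x \<otimes>\<^bsub>G\<^esub> e i \<in> Orb"
        proof -
          obtain j where j: "j \<in> I" "x \<otimes>\<^bsub>G\<^esub> e i = g \<otimes>\<^bsub>G\<^esub> e j"
            using xO unfolding Orb_def by blast
          have ei: "e i \<in> carrier G" "e j \<in> carrier G" using i j H.subset by auto
          have xG: "x \<in> carrier G" using x psubset.prems(1) by blast
          have "e j \<otimes>\<^bsub>G\<^esub> inv\<^bsub>G\<^esub> e i \<in> e ` I"
            using i j by (intro H.m_closed H.m_inv_closed) auto
          then obtain l where l: "l \<in> I" "e l = e j \<otimes>\<^bsub>G\<^esub> inv\<^bsub>G\<^esub> e i" by (metis imageE)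
          have "x = x \<otimes>\<^bsub>G\<^esub> e i \<otimes>\<^bsub>G\<^esub> inv\<^bsub>G\<^esub> e i"
            using xG ei by (simp add: m_assoc)
          also have "\<dots> = g \<otimes>\<^bsub>G\<^esub> e l"
            unfolding j(2) l(2) using gG ei by (simp add: m_assoc)
          finally have "x = g \<otimes>\<^bsub>G\<^esub> e l" .
          with l(1) show ?thesis by (auto simp: Orb_def)
        qed
        with x i psubset.prems(2) show ?thesis by auto
      qed
      show "(\<Sum>i\<in>I. \<phi> (x \<otimes>\<^bsub>G\<^esub> e i)) = 0" if "x \<in> A - Orb" for x
        using that psubset.prems(3) by blast
    qed
    ultimately show ?thesis
      using sum.subset_diff[OF Orb psubset.hyps(1), of \<phi>] by simp
  qed simp
qed

section \<open>Orthogonality of additive characters of matrix spaces\<close>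

lemma character_add: "nontrivial_character \<psi> \<Longrightarrow> \<psi> (x + y) = \<psi> x * \<psi> y"
  by (simp add: nontrivial_character_def)

lemma character_zero:
  assumes "nontrivial_character \<psi>" shows "\<psi> 0 = 1"
proof -
  have "\<psi> 0 * \<psi> 0 = \<psi> 0" "\<psi> 0 \<noteq> 0"
    using assms character_add[OF assms, of 0 0] by (auto simp: nontrivial_character_def)
  then show ?thesis by simp
qed

text \<open>Translating \<open>X\<close> by a suitable \<open>Y\<close> multiplies the sum by some
  \<open>\<psi> t\<close> different from 1, so the sum is zero.\<close>

lemma sum_character_mtrace:
  fixes C :: "'k::{field,finite} mat"
  assumes \<psi>: "nontrivial_character \<psi>" and C: "C \<in> carrier_mat l m" "C \<noteq> 0\<^sub>m l m"
  shows "(\<Sum>X\<in>carrier_mat m l. \<psi> (mtrace (C * X))) = 0"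
proof -
  obtain i j where ij: "i < l" "j < m" "C $$ (i, j) \<noteq> 0"
    using C by (metis carrier_matD eq_matI index_zero_mat)
  obtain t where t: "\<psi> t \<noteq> 1"
    using \<psi> by (auto simp: nontrivial_character_def)
  \<comment> \<open>The only nonzero entry of \<open>Y\<close> sits opposite a nonzero entry of
    \<open>C\<close> and is scaled so that the trace of \<open>C * Y\<close> is
    \<open>t\<close>.\<close>
  define Y where "Y = mat m l (\<lambda>(a, b). if a = j \<and> b = i then t / C $$ (i, j) else 0)"
  have Y: "Y \<in> carrier_mat m l" by (simp add: Y_def)
  have "mtrace (C * Y) = (\<Sum>a<l. \<Sum>b<m. C $$ (a, b) * Y $$ (b, a))"
    using C Y by (auto simp: mtrace_def scalar_prod_def atLeast0LessThan intro!: sum.cong)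
  also have "\<dots> = (\<Sum>a<l. if a = i then t else 0)"
  proof (rule sum.cong[OF refl])
    fix a assume a: "a \<in> {..<l}"
    have "(\<Sum>b<m. C $$ (a, b) * Y $$ (b, a)) = (\<Sum>b<m. if b = j then (if a = i then t else 0) else 0)"
      using ij a by (intro sum.cong) (auto simp: Y_def)
    also have "\<dots> = (if a = i then t else 0)" using ij by simp
    finally show "(\<Sum>b<m. C $$ (a, b) * Y $$ (b, a)) = (if a = i then t else 0)" .
  qed
  also have "\<dots> = t" using ij by simp
  finally have tr: "mtrace (C * Y) = t" .
  have bij: "bij_betw (\<lambda>X. X + Y) (carrier_mat m l) (carrier_mat m l)"
    by (rule bij_betw_byWitness[where f' = "\<lambda>X. X - Y"])
      (use Y in \<open>auto simp: add_uminus_minus_mat[symmetric] assoc_add_mat[of _ m l]\<close>)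
  have "(\<Sum>X\<in>carrier_mat m l. \<psi> (mtrace (C * X))) = (\<Sum>X\<in>carrier_mat m l. \<psi> (mtrace (C * (X + Y))))"
    by (rule sum.reindex_bij_betw[OF bij, symmetric])
  also have "\<dots> = (\<Sum>X\<in>carrier_mat m l. \<psi> t * \<psi> (mtrace (C * X)))"
  proof (rule sum.cong[OF refl])
    fix X :: "'k mat" assume X: "X \<in> carrier_mat m l"
    have "mtrace (C * (X + Y)) = mtrace (C * X) + t"
      using C X Y by (simp add: mult_add_distrib_mat[of _ l m _ l] mtrace_add[of _ l] tr)
    then show "\<psi> (mtrace (C * (X + Y))) = \<psi> t * \<psi> (mtrace (C * X))"
      by (simp add: character_add[OF \<psi>] mult.commute)
  qed
  also have "\<dots> = \<psi> t * (\<Sum>X\<in>carrier_mat m l. \<psi> (mtrace (C * X)))"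
    by (simp add: sum_distrib_left)
  finally have "(1 - \<psi> t) * (\<Sum>X\<in>carrier_mat m l. \<psi> (mtrace (C * X))) = 0"
    by (simp add: algebra_simps)
  with t show ?thesis by simp
qed

text \<open>The unnormalised Fourier transform of \<open>f\<close> extended by zero to singular
  matrices. Values lie in any vector space, so the same notion serves for operators applied to a
  vector and for single coordinates.\<close>

definition gl_fourier ::
  "('r \<Rightarrow> 'v \<Rightarrow> 'v::ab_group_add) \<Rightarrow> nat \<Rightarrow> ('k::field \<Rightarrow> 'r) \<Rightarrow> ('k mat \<Rightarrow> 'v) \<Rightarrow> 'k mat \<Rightarrow> 'v" where
  "gl_fourier s n \<psi> f a = (\<Sum>g\<in>carrier (GL n). s (\<psi> (mtrace (a * g))) (f g))"

text \<open>For \<open>f g = \<pi> (inv g) v\<close> this is the condition under which the weak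
  functional equation extends to all \<open>\<Phi>\<close>.\<close>

definition vanishes_on_singular ::
  "('r \<Rightarrow> 'v \<Rightarrow> 'v::ab_group_add) \<Rightarrow> nat \<Rightarrow> ('k::field \<Rightarrow> 'r) \<Rightarrow> ('k mat \<Rightarrow> 'v) \<Rightarrow> bool" where
  "vanishes_on_singular s n \<psi> f \<longleftrightarrow>
     (\<forall>a\<in>carrier_mat n n. det a = 0 \<longrightarrow> gl_fourier s n \<psi> f a = 0)"

lemma vanishes_on_singularD:
  "vanishes_on_singular s n \<psi> f \<Longrightarrow> a \<in> carrier_mat n n \<Longrightarrow> det a = 0 \<Longrightarrow> gl_fourier s n \<psi> f a = 0"
  by (simp add: vanishes_on_singular_def)

lemma vanishes_on_singular_cong:
  "(\<And>g. g \<in> carrier (GL n) \<Longrightarrow> f g = f' g) \<Longrightarrow>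
    vanishes_on_singular s n \<psi> f = vanishes_on_singular s n \<psi> f'"
  by (simp add: vanishes_on_singular_def gl_fourier_def cong: sum.cong)

section \<open>Unipotent and Levi subgroups as index sets of orbit sums\<close>

lemma subgroup_unip: "subgroup (unip m l ` carrier_mat m l) (GL (m + l) :: 'k::field mat monoid)"
proof (rule subgroup.intro)
  show "\<one>\<^bsub>GL (m + l)\<^esub> \<in> unip m l ` carrier_mat m l"
    by (metis GL_one image_eqI unip_zero zero_carrier_mat)
qed (auto simp: unip_GL unip_mult unip_inv)

lemma subgroup_bdiag_left:
  "subgroup ((\<lambda>h. bdiag h (1\<^sub>m l)) ` carrier (GL m)) (GL (m + l) :: 'k::field mat monoid)"
proof (rule subgroup.intro)
  show "\<one>\<^bsub>GL (m + l)\<^esub> \<in> (\<lambda>h. bdiag h (1\<^sub>m l)) ` carrier (GL m)"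
    by (metis GL_one image_eqI bdiag_one GL_one_closed)
next
  fix x y :: "'k mat"
  assume "x \<in> (\<lambda>h. bdiag h (1\<^sub>m l)) ` carrier (GL m)" "y \<in> (\<lambda>h. bdiag h (1\<^sub>m l)) ` carrier (GL m)"
  then obtain h h' where h: "h \<in> carrier (GL m)" "h' \<in> carrier (GL m)"
    and "x = bdiag h (1\<^sub>m l)" "y = bdiag h' (1\<^sub>m l)" by blast
  then have "x \<otimes>\<^bsub>GL (m + l)\<^esub> y = bdiag (h * h') (1\<^sub>m l)"
    by (simp add: bdiag_mult[of _ m _ _ l] GL_carrier_mat)
  with h show "x \<otimes>\<^bsub>GL (m + l)\<^esub> y \<in> (\<lambda>h. bdiag h (1\<^sub>m l)) ` carrier (GL m)"
    by (auto intro: GL_mult_closed)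
qed (auto simp: bdiag_GL GL_one_closed bdiag_inv GL_inv_one GL_inv_closed)

lemma subgroup_bdiag_right:
  "subgroup ((\<lambda>h. bdiag (1\<^sub>m m) h) ` carrier (GL l)) (GL (m + l) :: 'k::field mat monoid)"
proof (rule subgroup.intro)
  show "\<one>\<^bsub>GL (m + l)\<^esub> \<in> (\<lambda>h. bdiag (1\<^sub>m m) h) ` carrier (GL l)"
    by (metis GL_one image_eqI bdiag_one GL_one_closed)
next
  fix x y :: "'k mat"
  assume "x \<in> (\<lambda>h. bdiag (1\<^sub>m m) h) ` carrier (GL l)" "y \<in> (\<lambda>h. bdiag (1\<^sub>m m) h) ` carrier (GL l)"
  then obtain h h' where h: "h \<in> carrier (GL l)" "h' \<in> carrier (GL l)"
    and "x = bdiag (1\<^sub>m m) h" "y = bdiag (1\<^sub>m m) h'" by blast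
  then have "x \<otimes>\<^bsub>GL (m + l)\<^esub> y = bdiag (1\<^sub>m m) (h * h')"
    by (simp add: bdiag_mult[of _ m _ _ l] GL_carrier_mat)
  with h show "x \<otimes>\<^bsub>GL (m + l)\<^esub> y \<in> (\<lambda>h. bdiag (1\<^sub>m m) h) ` carrier (GL l)"
    by (auto intro: GL_mult_closed)
qed (auto simp: bdiag_GL GL_one_closed bdiag_inv GL_inv_one GL_inv_closed)

lemma inj_on_unip: "inj_on (unip m l) (carrier_mat m l)"
proof (rule inj_onI)
  fix X Y :: "'a mat" assume XY: "X \<in> carrier_mat m l" "Y \<in> carrier_mat m l" "unip m l X = unip m l Y"
  show "X = Y"
  proof (rule eq_matI)
    fix i j assume "i < dim_row Y" "j < dim_col Y"
    with XY(1,2) arg_cong[OF XY(3), of "\<lambda>A. A $$ (i, m + j)"] show "X $$ (i, j) = Y $$ (i, j)"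
      by (simp add: unip_def)
  qed (use XY in auto)
qed

lemma inj_on_bdiag_left: "inj_on (\<lambda>h. bdiag h (1\<^sub>m l)) (carrier (GL m))"
proof (rule inj_onI)
  fix X Y :: "'a mat"
  assume XY: "X \<in> carrier (GL m)" "Y \<in> carrier (GL m)" "bdiag X (1\<^sub>m l) = bdiag Y (1\<^sub>m l)"
  show "X = Y"
  proof (rule eq_matI)
    fix i j assume "i < dim_row Y" "j < dim_col Y"
    with XY(1,2)[THEN GL_carrier_mat] arg_cong[OF XY(3), of "\<lambda>A. A $$ (i, j)"]
    show "X $$ (i, j) = Y $$ (i, j)" by (simp add: bdiag_def)
  qed (use XY(1,2)[THEN GL_carrier_mat] in auto)
qed

lemma inj_on_bdiag_right: "inj_on (\<lambda>h. bdiag (1\<^sub>m m) h) (carrier (GL l))"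
proof (rule inj_onI)
  fix X Y :: "'a mat"
  assume XY: "X \<in> carrier (GL l)" "Y \<in> carrier (GL l)" "bdiag (1\<^sub>m m) X = bdiag (1\<^sub>m m) Y"
  show "X = Y"
  proof (rule eq_matI)
    fix i j assume "i < dim_row Y" "j < dim_col Y"
    with XY(1,2)[THEN GL_carrier_mat] arg_cong[OF XY(3), of "\<lambda>A. A $$ (m + i, m + j)"]
    show "X $$ (i, j) = Y $$ (i, j)" by (simp add: bdiag_def)
  qed (use XY(1,2)[THEN GL_carrier_mat] in auto)
qed

text \<open>Comparing the first block column is enough to keep the pieces of the group in the next
  proof disjoint.\<close>

lemma four_block_eqD:
  assumes c: "A \<in> carrier_mat m m" "B \<in> carrier_mat m l" "C \<in> carrier_mat l m" "D \<in> carrier_mat l l"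
    "A' \<in> carrier_mat m m" "B' \<in> carrier_mat m l" "C' \<in> carrier_mat l m" "D' \<in> carrier_mat l l"
    and eq: "four_block_mat A B C D = four_block_mat A' B' C' D'"
  shows "A = A' \<and> C = C'"
proof -
  have "A $$ (i, j) = A' $$ (i, j)" if "i < m" "j < m" for i j
    using arg_cong[OF eq, of "\<lambda>M. M $$ (i, j)"] that c by simp
  moreover have "C $$ (i, j) = C' $$ (i, j)" if "i < l" "j < m" for i j
    using arg_cong[OF eq, of "\<lambda>M. M $$ (m + i, j)"] that c by simp
  ultimately show ?thesis
    using c by (intro conjI eq_matI) auto
qed

text \<open>The group is cut according to the blocks of \<open>a * g\<close>. Where the lower left
  block \<open>C\<close> is nonzero, right multiplication by the unipotent radical leaves
  \<open>f\<close> alone and multiplies the character value by \<open>\<psi>\<close> of the trace of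
  \<open>C * X\<close>, which sums to zero. Where \<open>C = 0\<close>, one diagonal block is
  singular, and an orbit of the corresponding Levi factor sums to a Fourier coefficient at that
  block.\<close>

lemma vanishes_on_singular_two_blocks:
  fixes f :: "'k::{field,finite} mat \<Rightarrow> 'v::ab_group_add"
  assumes vs: "vector_space s" and \<psi>: "nontrivial_character \<psi>"
    and U: "\<And>g X. g \<in> carrier (GL (m + l)) \<Longrightarrow> X \<in> carrier_mat m l \<Longrightarrow> f (g * unip m l X) = f g"
    and L: "\<And>g. g \<in> carrier (GL (m + l)) \<Longrightarrow>
      vanishes_on_singular s m \<psi> (\<lambda>h. f (g * bdiag h (1\<^sub>m l)))"
    and R: "\<And>g. g \<in> carrier (GL (m + l)) \<Longrightarrow>
      vanishes_on_singular s l \<psi> (\<lambda>h. f (g * bdiag (1\<^sub>m m) h))"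
  shows "vanishes_on_singular s (m + l) \<psi> f"
  unfolding vanishes_on_singular_def
proof (intro ballI impI)
  fix a :: "'k mat" assume a: "a \<in> carrier_mat (m + l) (m + l)" and det: "det a = 0"
  interpret vector_space s by (rule vs)
  let ?G = "carrier (GL (m + l)) :: 'k mat set"
  let ?t = "\<lambda>g. s (\<psi> (mtrace (a * g))) (f g)"
  define blk where "blk g A B C D \<longleftrightarrow> A \<in> carrier_mat m m \<and> B \<in> carrier_mat m l \<and>
    C \<in> carrier_mat l m \<and> D \<in> carrier_mat l l \<and> a * g = four_block_mat A B C D" for g A B C D
  \<comment> \<open>\<open>A1\<close> is stable under the unipotent radical, \<open>A2\<close> under
    the upper and \<open>A3\<close> under the lower Levi factor. The condition
    \<open>det A \<noteq> 0\<close> in \<open>A3\<close> keeps it apart from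
    \<open>A2\<close>.\<close>
  define A1 where "A1 = {g \<in> ?G. \<exists>A B C D. blk g A B C D \<and> C \<noteq> 0\<^sub>m l m}"
  define A2 where "A2 = {g \<in> ?G. \<exists>A B D. blk g A B (0\<^sub>m l m) D \<and> det A = 0}"
  define A3 where "A3 = {g \<in> ?G. \<exists>A B D. blk g A B (0\<^sub>m l m) D \<and> det A \<noteq> 0 \<and> det D = 0}"
  have blk_unique: "C = C' \<and> A = A'" if "blk g A B C D" "blk g A' B' C' D'" for g A B C D A' B' C' D'
    using that four_block_eqD[of A m B l C D A' B' C' D'] by (auto simp: blk_def)
  have assoc: "a * (g * h) = a * g * h" if "g \<in> ?G" "h \<in> ?G" for g h
    using a that by (simp add: assoc_mult_mat[of _ "m + l" "m + l" _ "m + l" _ "m + l"] GL_carrier_mat)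
  \<comment> \<open>A unipotent element changes only the second block column, so \<open>C\<close> is
    constant along the orbit and the trace grows by that of \<open>C * X\<close>.\<close>
  have blk_unip: "blk (g * unip m l X) A (A * X + B) C (C * X + D)"
    if "blk g A B C D" "g \<in> ?G" "X \<in> carrier_mat m l" for g A B C D X
    using that assoc[OF that(2) unip_GL[OF that(3)]] unfolding blk_def unip_def
    by (auto simp: mult_four_block_mat[of _ m m _ l _ l _ _ m _ l])
  have blk_left: "blk (g * bdiag h (1\<^sub>m l)) (A * h) B (C * h) D"
    if "blk g A B C D" "g \<in> ?G" "h \<in> carrier (GL m)" for g A B C D h
    using that(1) GL_carrier_mat[OF that(3)] assoc[OF that(2) bdiag_GL[OF that(3) GL_one_closed]]
    unfolding blk_def bdiag_def
    by (auto simp: mult_four_block_mat[of _ m m _ l _ l _ _ m _ l])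
  have blk_right: "blk (g * bdiag (1\<^sub>m m) h) A (B * h) C (D * h)"
    if "blk g A B C D" "g \<in> ?G" "h \<in> carrier (GL l)" for g A B C D h
    using that(1) GL_carrier_mat[OF that(3)] assoc[OF that(2) bdiag_GL[OF GL_one_closed that(3)]]
    unfolding blk_def bdiag_def
    by (auto simp: mult_four_block_mat[of _ m m _ l _ l _ _ m _ l])
  have tr: "\<psi> (mtrace (a * g)) = \<psi> (mtrace A) * \<psi> (mtrace D)" if "blk g A B C D" for g A B C D
    using that by (auto simp: blk_def mtrace_four_block character_add[OF \<psi>])
  have "(\<Sum>g\<in>A1. ?t g) = 0"
  proof (rule sum_eq_0_by_orbits[OF group_GL subgroup_unip inj_on_unip])
    fix g assume "g \<in> A1"
    then obtain A B C D where g: "g \<in> ?G" "blk g A B C D" "C \<noteq> 0\<^sub>m l m" by (auto simp: A1_def)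
    have C: "C \<in> carrier_mat l m" "A \<in> carrier_mat m m" "D \<in> carrier_mat l l"
      using g(2) by (auto simp: blk_def)
    have "(\<Sum>X\<in>carrier_mat m l. ?t (g * unip m l X)) =
      (\<Sum>X\<in>carrier_mat m l. s (\<psi> (mtrace A) * \<psi> (mtrace D) * \<psi> (mtrace (C * X))) (f g))"
    proof (rule sum.cong[OF refl])
      fix X :: "'k mat" assume X: "X \<in> carrier_mat m l"
      have "\<psi> (mtrace (C * X + D)) = \<psi> (mtrace D) * \<psi> (mtrace (C * X))"
        using C X by (simp add: mtrace_add[of _ l] character_add[OF \<psi>])
      then show "?t (g * unip m l X) = s (\<psi> (mtrace A) * \<psi> (mtrace D) * \<psi> (mtrace (C * X))) (f g)"
        by (simp add: U[OF g(1) X] tr[OF blk_unip[OF g(2,1) X]] mult.assoc)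
    qed
    also have "\<dots> = 0"
      using sum_character_mtrace[OF \<psi> C(1) g(3)]
      by (simp add: scale_sum_left[symmetric] sum_distrib_left[symmetric])
    finally show "(\<Sum>X\<in>carrier_mat m l. ?t (g \<otimes>\<^bsub>GL (m + l)\<^esub> unip m l X)) = 0" by simp
  next
    fix g X :: "'k mat" assume "g \<in> A1" and X: "X \<in> carrier_mat m l"
    then obtain A B C D where g: "g \<in> ?G" "blk g A B C D" "C \<noteq> 0\<^sub>m l m" by (auto simp: A1_def)
    show "g \<otimes>\<^bsub>GL (m + l)\<^esub> unip m l X \<in> A1"
      using blk_unip[OF g(2,1) X] g(3) GL_mult_closed[OF g(1) unip_GL[OF X]] by (auto simp: A1_def)
  qed (auto simp: A1_def intro: finite_subset[OF _ finite_GL])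
  moreover have "(\<Sum>g\<in>A2. ?t g) = 0"
  proof (rule sum_eq_0_by_orbits[OF group_GL subgroup_bdiag_left inj_on_bdiag_left])
    fix g assume "g \<in> A2"
    then obtain A B D where g: "g \<in> ?G" "blk g A B (0\<^sub>m l m) D" "det A = 0" by (auto simp: A2_def)
    have A: "A \<in> carrier_mat m m" using g(2) by (auto simp: blk_def)
    \<comment> \<open>Along the orbit the trace is that of \<open>A * h\<close> plus the constant
      trace of \<open>D\<close>, so the orbit sum is a multiple of a Fourier coefficient at the
      singular matrix \<open>A\<close>.\<close>
    have "(\<Sum>h\<in>carrier (GL m). ?t (g * bdiag h (1\<^sub>m l))) =
      s (\<psi> (mtrace D)) (gl_fourier s m \<psi> (\<lambda>h. f (g * bdiag h (1\<^sub>m l))) A)"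
      unfolding gl_fourier_def scale_sum_right
      by (rule sum.cong[OF refl]) (simp add: tr[OF blk_left[OF g(2,1)]] mult.commute)
    then show "(\<Sum>h\<in>carrier (GL m). ?t (g \<otimes>\<^bsub>GL (m + l)\<^esub> bdiag h (1\<^sub>m l))) = 0"
      using vanishes_on_singularD[OF L[OF g(1)] A g(3)] by simp
  next
    fix g h :: "'k mat" assume "g \<in> A2" and h: "h \<in> carrier (GL m)"
    then obtain A B D where g: "g \<in> ?G" "blk g A B (0\<^sub>m l m) D" "det A = 0" by (auto simp: A2_def)
    have A: "A \<in> carrier_mat m m" using g(2) by (auto simp: blk_def)
    show "g \<otimes>\<^bsub>GL (m + l)\<^esub> bdiag h (1\<^sub>m l) \<in> A2"
      using blk_left[OF g(2,1) h] g(3) GL_mult_closed[OF g(1) bdiag_GL[OF h GL_one_closed]]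
        det_mult[OF A GL_carrier_mat[OF h]] left_mult_zero_mat[OF GL_carrier_mat[OF h], of l]
      by (auto simp: A2_def) 
  qed (auto simp: A2_def intro: finite_subset[OF _ finite_GL])
  moreover have "(\<Sum>g\<in>A3. ?t g) = 0"
  proof (rule sum_eq_0_by_orbits[OF group_GL subgroup_bdiag_right inj_on_bdiag_right])
    fix g assume "g \<in> A3"
    then obtain A B D where g: "g \<in> ?G" "blk g A B (0\<^sub>m l m) D" "det A \<noteq> 0" "det D = 0"
      by (auto simp: A3_def)
    have D: "D \<in> carrier_mat l l" using g(2) by (auto simp: blk_def)
    have "(\<Sum>h\<in>carrier (GL l). ?t (g * bdiag (1\<^sub>m m) h)) =
      s (\<psi> (mtrace A)) (gl_fourier s l \<psi> (\<lambda>h. f (g * bdiag (1\<^sub>m m) h)) D)"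
      unfolding gl_fourier_def scale_sum_right
      by (rule sum.cong[OF refl]) (simp add: tr[OF blk_right[OF g(2,1)]])
    then show "(\<Sum>h\<in>carrier (GL l). ?t (g \<otimes>\<^bsub>GL (m + l)\<^esub> bdiag (1\<^sub>m m) h)) = 0"
      using vanishes_on_singularD[OF R[OF g(1)] D g(4)] by simp
  next
    fix g h :: "'k mat" assume "g \<in> A3" and h: "h \<in> carrier (GL l)"
    then obtain A B D where g: "g \<in> ?G" "blk g A B (0\<^sub>m l m) D" "det A \<noteq> 0" "det D = 0"
      by (auto simp: A3_def)
    have D: "D \<in> carrier_mat l l" using g(2) by (auto simp: blk_def)
    show "g \<otimes>\<^bsub>GL (m + l)\<^esub> bdiag (1\<^sub>m m) h \<in> A3"
      using blk_right[OF g(2,1) h] g(3,4) GL_mult_closed[OF g(1) bdiag_GL[OF GL_one_closed h]]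
        det_mult[OF D GL_carrier_mat[OF h]]
      by (auto simp: A3_def)
  qed (auto simp: A3_def intro: finite_subset[OF _ finite_GL])
  moreover have "?G = A1 \<union> (A2 \<union> A3)"
  proof
    show "?G \<subseteq> A1 \<union> (A2 \<union> A3)"
    proof
      fix g assume g: "g \<in> ?G"
      have ag: "a * g \<in> carrier_mat (m + l) (m + l)" using a GL_carrier_mat[OF g] by simp
      obtain A B C D where blk: "blk g A B C D"
        using four_block_decomp[OF ag] unfolding blk_def by metis
      \<comment> \<open>Since \<open>a\<close> is singular, so is \<open>a * g\<close>, and for
        \<open>C = 0\<close> its determinant is the product of those of the diagonal blocks.\<close>
      have "det A = 0 \<or> det D = 0" if C: "C = 0\<^sub>m l m"
      proof -
        have "det (a * g) = det A * det D"
          using blk C by (auto simp: blk_def det_four_block_mat_lower_left_zero[of _ m _ l])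
        then show ?thesis using det det_mult[OF a GL_carrier_mat[OF g]] by simp
      qed
      moreover have "g \<in> A1" if "C \<noteq> 0\<^sub>m l m"
        using that g blk unfolding A1_def by blast
      moreover have "g \<in> A2" if "C = 0\<^sub>m l m" "det A = 0"
        using that g blk unfolding A2_def by blast
      moreover have "g \<in> A3" if "C = 0\<^sub>m l m" "det A \<noteq> 0" "det D = 0"
        using that g blk unfolding A3_def by blast
      ultimately show "g \<in> A1 \<union> (A2 \<union> A3)" by blast
    qed
  qed (auto simp: A1_def A2_def A3_def)
  moreover have "A1 \<inter> (A2 \<union> A3) = {}" "A2 \<inter> A3 = {}"
    using blk_unique by (fastforce simp: A1_def A2_def A3_def)+
  moreover have "finite A1" "finite A2" "finite A3"
    by (auto simp: A1_def A2_def A3_def intro: finite_subset[OF _ finite_GL])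
  ultimately show "gl_fourier s (m + l) \<psi> f a = 0"
    by (simp add: gl_fourier_def sum.union_disjoint)
qed

section \<open>Representations\<close>

lemma gl_fourier_translate_left:
  assumes h: "h \<in> carrier (GL n)" and a: "a \<in> carrier_mat n n"
  shows "gl_fourier s n \<psi> (\<lambda>g. f (h * g)) a = gl_fourier s n \<psi> f (a * inv\<^bsub>GL n\<^esub> h)"
proof -
  have "a * inv\<^bsub>GL n\<^esub> h * (h * g) = a * g" if "g \<in> carrier (GL n)" for g
  proof -
    have "a * inv\<^bsub>GL n\<^esub> h * (h * g) = a * (inv\<^bsub>GL n\<^esub> h * h * g)"
      using a GL_carrier_mat[OF h] GL_carrier_mat[OF GL_inv_closed[OF h]] GL_carrier_mat[OF that]
      by (simp add: assoc_mult_mat[of _ n n _ n _ n])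
    also have "\<dots> = a * g"
      using GL_inv_left[OF h] GL_carrier_mat[OF that] by simp
    finally show ?thesis .
  qed
  then show ?thesis
    unfolding gl_fourier_def
    by (subst (2) sum.reindex_bij_betw[OF bij_betw_GL_mult_left[OF h], symmetric])
      (auto intro!: sum.cong)
qed

lemma gl_fourier_translate_right:
  fixes a :: "'k::field mat"
  assumes h: "h \<in> carrier (GL n)" and a: "a \<in> carrier_mat n n"
  shows "gl_fourier s n \<psi> (\<lambda>g. f (g * h)) a = gl_fourier s n \<psi> f (inv\<^bsub>GL n\<^esub> h * a)"
proof -
  have "mtrace (inv\<^bsub>GL n\<^esub> h * a * (g * h)) = mtrace (a * g)" if "g \<in> carrier (GL n)" for g
  proof -
    note c = a GL_carrier_mat[OF h] GL_carrier_mat[OF GL_inv_closed[OF h]] GL_carrier_mat[OF that]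
    have "mtrace (inv\<^bsub>GL n\<^esub> h * a * (g * h)) = mtrace (inv\<^bsub>GL n\<^esub> h * (a * (g * h)))"
      using c by (simp add: assoc_mult_mat[of _ n n _ n _ n])
    \<comment> \<open>Cyclicity of the trace cancels the factor to the right of \<open>g\<close>
      against the one to the left of \<open>a\<close>.\<close>
    also have "\<dots> = mtrace (a * (g * h) * inv\<^bsub>GL n\<^esub> h)"
      using c by (intro mtrace_comm) auto
    also have "a * (g * h) * inv\<^bsub>GL n\<^esub> h = a * g * (h * inv\<^bsub>GL n\<^esub> h)"
      using c by (simp add: assoc_mult_mat[of _ n n _ n _ n])
    also have "\<dots> = a * g"
      using GL_inv_right[OF h] c by simp
    finally show ?thesis .
  qed
  then show ?thesis
    unfolding gl_fourier_def
    by (subst (2) sum.reindex_bij_betw[OF bij_betw_GL_mult_right[OF h], symmetric])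
      (auto intro!: sum.cong)
qed

lemma linear_on_sum:
  assumes "vector_space s" and V: "module.subspace s V" and f: "linear_on s V t W f"
    and "finite I" and "\<And>i. i \<in> I \<Longrightarrow> x i \<in> V"
  shows "f (\<Sum>i\<in>I. s (c i) (x i)) = (\<Sum>i\<in>I. t (c i) (f (x i)))"
proof -
  interpret vector_space s by fact
  \<comment> \<open>\<open>linear_on\<close> gives additivity on \<open>V\<close> only, so the value
    at 0 is found from \<open>0 + 0 = 0\<close> inside \<open>V\<close>.\<close>
  have "f (0 + 0) = f 0 + f 0"
    using f subspace_0[OF V] by (simp only: linear_on_def)
  then have f0: "f 0 = 0" by simp
  show ?thesis
    using assms(4,5)
  proof (induction I rule: finite_induct)
    case (insert i I)
    have "s (c i) (x i) \<in> V" "(\<Sum>i\<in>I. s (c i) (x i)) \<in> V"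
      using insert.prems V by (auto intro!: subspace_scale subspace_sum)
    with insert f show ?case by (simp add: linear_on_def)
  qed (simp add: f0)
qed

lemma representationD:
  assumes "is_representation (GL n) s V \<pi>"
  shows "vector_space s" "module.subspace s V"
    "g \<in> carrier (GL n) \<Longrightarrow> linear_on s V s V (\<pi> g)"
    "g \<in> carrier (GL n) \<Longrightarrow> v \<in> V \<Longrightarrow> \<pi> g v \<in> V"
    "v \<in> V \<Longrightarrow> \<pi> (1\<^sub>m n) v = v"
    "g \<in> carrier (GL n) \<Longrightarrow> h \<in> carrier (GL n) \<Longrightarrow> v \<in> V \<Longrightarrow> \<pi> (g * h) v = \<pi> g (\<pi> h v)"
  using assms by (auto simp: is_representation_def linear_on_def image_subset_iff)

lemma gl_fourier_in_subspace:
  assumes "vector_space s" "module.subspace s V" "\<And>g. g \<in> carrier (GL n) \<Longrightarrow> f g \<in> V"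
  shows "gl_fourier s n \<psi> f a \<in> V"
proof -
  interpret vector_space s by fact
  show ?thesis
    unfolding gl_fourier_def using assms by (auto intro!: subspace_sum subspace_scale)
qed

lemma linear_on_gl_fourier:
  fixes f :: "'k::{field,finite} mat \<Rightarrow> 'v::ab_group_add"
  assumes "vector_space s" "module.subspace s V" "linear_on s V t W F"
    "\<And>g. g \<in> carrier (GL n) \<Longrightarrow> f g \<in> V"
  shows "F (gl_fourier s n \<psi> f a) = gl_fourier t n \<psi> (\<lambda>g. F (f g)) a"
  unfolding gl_fourier_def using assms by (intro linear_on_sum) (auto simp: finite_GL)

text \<open>Turns the action on a coefficient into a change of \<open>a\<close>; in particular
  \<open>a * inv k = a\<close> makes the coefficient a vector fixed by \<open>k\<close>.\<close>

lemma rep_gl_fourier: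
  fixes \<pi> :: "'k::{field,finite} mat \<Rightarrow> 'v::ab_group_add \<Rightarrow> 'v"
  assumes rep: "is_representation (GL n) s V \<pi>"
    and k: "k \<in> carrier (GL n)" and a: "a \<in> carrier_mat n n" and v: "v \<in> V"
  shows "\<pi> k (gl_fourier s n \<psi> (\<lambda>g. \<pi> g v) a) = gl_fourier s n \<psi> (\<lambda>g. \<pi> g v) (a * inv\<^bsub>GL n\<^esub> k)"
proof -
  note R = representationD[OF rep]
  have "\<pi> k (gl_fourier s n \<psi> (\<lambda>g. \<pi> g v) a) = gl_fourier s n \<psi> (\<lambda>g. \<pi> k (\<pi> g v)) a"
    using R v k by (intro linear_on_gl_fourier) auto
  also have "\<dots> = gl_fourier s n \<psi> (\<lambda>g. \<pi> (k * g) v) a"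
    unfolding gl_fourier_def using R(6)[OF k _ v] by (auto intro!: sum.cong)
  finally show ?thesis
    using gl_fourier_translate_left[OF k a, of s \<psi> "\<lambda>g. \<pi> g v"] by simp
qed

lemma index_mult_mat_sum:
  assumes "A \<in> carrier_mat m n" "B \<in> carrier_mat n l" "i < m" "j < l"
  shows "(A * B) $$ (i, j) = (\<Sum>x<n. A $$ (i, x) * B $$ (x, j))"
  using assms by (simp add: scalar_prod_def atLeast0LessThan)

text \<open>The product can differ from \<open>c\<close> only through the first row of
  \<open>p\<close>, and that row is multiplied by the zero column of \<open>c\<close>.\<close>

lemma mult_eq_if_col_0:
  fixes c p :: "'k::comm_semiring_1 mat"
  assumes c: "c \<in> carrier_mat n n" and p: "p \<in> carrier_mat n n"
    and col: "\<And>i. i < n \<Longrightarrow> c $$ (i, 0) = 0"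
    and p1: "\<And>i j. 0 < i \<Longrightarrow> i < n \<Longrightarrow> j < n \<Longrightarrow> p $$ (i, j) = 1\<^sub>m n $$ (i, j)"
  shows "c * p = c"
proof (rule eq_matI)
  fix i j assume "i < dim_row c" "j < dim_col c"
  then have ij: "i < n" "j < n" using c by auto
  have "(c * p) $$ (i, j) = (\<Sum>l<n. c $$ (i, l) * p $$ (l, j))"
    by (rule index_mult_mat_sum[OF c p ij])
  also have "\<dots> = (\<Sum>l<n. if l = j then c $$ (i, j) else 0)"
  proof (rule sum.cong[OF refl])
    fix l assume "l \<in> {..<n}"
    then show "c $$ (i, l) * p $$ (l, j) = (if l = j then c $$ (i, j) else 0)"
      using col[OF ij(1)] p1[of l j] ij by (cases "l = 0") auto
  qed
  also have "\<dots> = c $$ (i, j)" using ij by simp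
  finally show "(c * p) $$ (i, j) = c $$ (i, j)" .
qed (use c p in auto)

section \<open>A vector with vanishing singular coefficients when q - 1 is zero in the coefficient
  field\<close>

lemma card_GL_1: "card (carrier (GL 1) :: 'k::{field,finite} mat set) = CARD('k) - 1"
proof -
  have "bij_betw (\<lambda>x. mat 1 1 (\<lambda>_. x)) (UNIV - {0 :: 'k}) (carrier (GL 1))"
  proof (rule bij_betw_byWitness[where f' = "\<lambda>g. g $$ (0, 0)"])
    show "\<forall>g\<in>carrier (GL 1). mat 1 1 (\<lambda>_. g $$ (0, 0)) = (g :: 'k mat)"
      by (auto simp: carrier_GL intro!: eq_matI)
  qed (auto simp: carrier_GL det_single)
  then have "card (carrier (GL 1) :: 'k mat set) = card (UNIV - {0 :: 'k})"
    by (rule bij_betw_same_card[symmetric])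
  then show ?thesis by (simp add: card_Diff_subset)
qed

lemma singular_1: "b \<in> carrier_mat 1 1 \<Longrightarrow> det b = 0 \<Longrightarrow> b = 0\<^sub>m 1 1"
  by (intro eq_matI) (auto simp: det_single)

lemma gl_fourier_zero:
  assumes \<psi>: "nontrivial_character \<psi>" and "vector_space s"
  shows "gl_fourier s n \<psi> f (0\<^sub>m n n) = (\<Sum>g\<in>carrier (GL n). f g)"
proof -
  interpret vector_space s by fact
  show ?thesis
    unfolding gl_fourier_def
    by (rule sum.cong[OF refl])
      (simp add: GL_carrier_mat left_mult_zero_mat[of _ n n] mtrace_def character_zero[OF \<psi>])
qed

text \<open>A Fourier coefficient at a singular matrix whose first column vanishes is a vector fixed by
  all matrices that agree with the identity below the first row. On the fixed vectors of this
  group the factor \<open>GL 1\<close> acts trivially, and its order vanishes in the coefficient field.\<close>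

lemma exists_vanishing_vector_step:
  fixes s :: "'r::field \<Rightarrow> 'v::ab_group_add \<Rightarrow> 'v" and \<pi> :: "'k::{field,finite} mat \<Rightarrow> 'v \<Rightarrow> 'v"
  assumes q: "of_nat (CARD('k) - 1) = (0::'r)" and \<psi>: "nontrivial_character \<psi>" and m: "m = 1"
    and rep: "is_representation (GL (m + n)) s S \<pi>" and S: "S \<noteq> {0}"
    and IH: "\<And>S (\<rho> :: 'k mat \<Rightarrow> 'v \<Rightarrow> 'v). is_representation (GL n) s S \<rho> \<Longrightarrow> S \<noteq> {0} \<Longrightarrow>
      \<exists>v\<in>S. v \<noteq> 0 \<and> vanishes_on_singular s n \<psi> (\<lambda>g. \<rho> g v)"
  shows "\<exists>v\<in>S. v \<noteq> 0 \<and> vanishes_on_singular s (m + n) \<psi> (\<lambda>g. \<pi> g v)"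
proof (rule ccontr)
  assume contra: "\<not> ?thesis"
  note R = representationD[OF rep]
  interpret vector_space s by (rule R(1))
  note U = unip_GL[of _ m n]
  have BL: "bdiag h (1\<^sub>m n) \<in> carrier (GL (m + n))" if "h \<in> carrier (GL m)" for h :: "'k mat"
    using that by (intro bdiag_GL GL_one_closed)
  have BR: "bdiag (1\<^sub>m m) h \<in> carrier (GL (m + n))" if "h \<in> carrier (GL n)" for h :: "'k mat"
    using that by (intro bdiag_GL GL_one_closed)
  \<comment> \<open>For \<open>m = 1\<close> these two families generate the invertible matrices
    that agree with the identity below the first row; the lower block \<open>GL n\<close> acts on
    their common fixed vectors through \<open>\<rho>\<close>.\<close>
  define S' where "S' = {v \<in> S. (\<forall>X\<in>carrier_mat m n. \<pi> (unip m n X) v = v) \<and>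
    (\<forall>h\<in>carrier (GL m). \<pi> (bdiag h (1\<^sub>m n)) v = v)}"
  define \<rho> where "\<rho> h = \<pi> (bdiag (1\<^sub>m m) h)" for h
  have "0 \<in> S" using subspace_0[OF R(2)] .
  with S obtain v where v: "v \<in> S" "v \<noteq> 0" by blast
  with contra obtain a where a: "a \<in> carrier_mat (m + n) (m + n)" "det a = 0"
    and nz: "gl_fourier s (m + n) \<psi> (\<lambda>g. \<pi> g v) a \<noteq> 0"
    by (auto simp: vanishes_on_singular_def)
  obtain k where k: "k \<in> carrier (GL (m + n))" and col: "\<And>i. i < m + n \<Longrightarrow> (a * k) $$ (i, 0) = 0"
    using singular_matrix_col_0[OF a] by blast
  define w where "w = gl_fourier s (m + n) \<psi> (\<lambda>g. \<pi> g v) (a * k)"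
  have ak: "a * k \<in> carrier_mat (m + n) (m + n)" using a GL_carrier_mat[OF k] by simp
  have w_eq: "w = \<pi> (inv\<^bsub>GL (m + n)\<^esub> k) (gl_fourier s (m + n) \<psi> (\<lambda>g. \<pi> g v) a)"
    using rep_gl_fourier[OF rep GL_inv_closed[OF k] a(1) v(1)] by (simp add: w_def GL_inv_inv[OF k])
  have wS: "gl_fourier s (m + n) \<psi> (\<lambda>g. \<pi> g v) b \<in> S" for b
    using R v by (intro gl_fourier_in_subspace) auto
  \<comment> \<open>Moving the zero column into place is the action of an invertible operator, so
    the coefficient stays nonzero.\<close>
  have "\<pi> k w = gl_fourier s (m + n) \<psi> (\<lambda>g. \<pi> g v) a"
    unfolding w_eq using R(5)[OF wS] R(6)[OF k GL_inv_closed[OF k] wS] by (simp add: GL_inv_right[OF k])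
  moreover have "\<pi> k 0 = 0"
    using R(3)[OF k] \<open>0 \<in> S\<close> by (metis linear_on_def scale_zero_left)
  ultimately have "w \<noteq> 0" using nz by auto
  have fixw: "\<pi> p w = w"
    if p: "p \<in> carrier (GL (m + n))" and p1: "\<And>i j. 0 < i \<Longrightarrow> i < m + n \<Longrightarrow> j < m + n \<Longrightarrow>
      p $$ (i, j) = 1\<^sub>m (m + n) $$ (i, j)" for p
  proof -
    have "a * k * p = a * k"
      by (rule mult_eq_if_col_0[OF ak GL_carrier_mat[OF p] col p1])
    then have "a * k * inv\<^bsub>GL (m + n)\<^esub> p = a * k * p * inv\<^bsub>GL (m + n)\<^esub> p" by simp
    also have "\<dots> = a * k * (p * inv\<^bsub>GL (m + n)\<^esub> p)"
      using ak GL_carrier_mat[OF p] GL_carrier_mat[OF GL_inv_closed[OF p]]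
      by (intro assoc_mult_mat)
    also have "\<dots> = a * k" unfolding GL_inv_right[OF p] by (rule right_mult_one_mat[OF ak])
    finally show ?thesis
      using rep_gl_fourier[OF rep p ak v(1), of \<psi>] by (simp add: w_def)
  qed
  \<comment> \<open>Here \<open>m = 1\<close> enters: all rows below the first are those of the
    identity.\<close>
  have fix_unip: "\<pi> (unip m n X) w = w" if X: "X \<in> carrier_mat m n" for X
    using X m by (intro fixw U) (auto simp: unip_def)
  have fix_bdiag: "\<pi> (bdiag h (1\<^sub>m n)) w = w" if h: "h \<in> carrier (GL m)" for h
    using GL_carrier_mat[OF h] m by (intro fixw BL h) (auto simp: bdiag_def)
  have "w \<in> S'"
    unfolding S'_def using wS[of "a * k"] fix_unip fix_bdiag by (simp add: w_def[symmetric])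
  with \<open>w \<noteq> 0\<close> have S'_nz: "S' \<noteq> {0}" by blast
  have S'_sub: "S' \<subseteq> S" by (auto simp: S'_def)
  have \<rho>_closed: "\<rho> h u \<in> S'" if h: "h \<in> carrier (GL n)" and u: "u \<in> S'" for h u
    unfolding S'_def
  proof (intro CollectI conjI ballI)
    have uS: "u \<in> S" using u S'_sub by blast
    show "\<rho> h u \<in> S" unfolding \<rho>_def using R(4)[OF BR[OF h] uS] .
    show "\<pi> (unip m n X) (\<rho> h u) = \<rho> h u" if X: "X \<in> carrier_mat m n" for X
    proof -
      have Xh: "X * h \<in> carrier_mat m n" using X GL_carrier_mat[OF h] by simp
      have "\<pi> (unip m n X) (\<rho> h u) = \<pi> (unip m n X * bdiag (1\<^sub>m m) h) u"
        unfolding \<rho>_def using R(6)[OF U[OF X] BR[OF h] uS] by simp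
      also have "\<dots> = \<rho> h (\<pi> (unip m n (X * h)) u)"
        unfolding \<rho>_def unip_bdiag_commute[OF X GL_carrier_mat[OF h]]
        using R(6)[OF BR[OF h] U[OF Xh] uS] .
      finally show ?thesis using u Xh by (simp add: S'_def)
    qed
    show "\<pi> (bdiag t (1\<^sub>m n)) (\<rho> h u) = \<rho> h u" if t: "t \<in> carrier (GL m)" for t
    proof -
      have "\<pi> (bdiag t (1\<^sub>m n)) (\<rho> h u) = \<pi> (bdiag t (1\<^sub>m n) * bdiag (1\<^sub>m m) h) u"
        unfolding \<rho>_def using R(6)[OF BL[OF t] BR[OF h] uS] by simp
      also have "\<dots> = \<rho> h (\<pi> (bdiag t (1\<^sub>m n)) u)"
        unfolding \<rho>_def bdiag_commute[OF GL_carrier_mat[OF t] GL_carrier_mat[OF h]]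
        using R(6)[OF BR[OF h] BL[OF t] uS] .
      finally show ?thesis using u t by (simp add: S'_def)
    qed
  qed
  have lin: "linear_on s S s S (\<pi> (unip m n X))" if "X \<in> carrier_mat m n" for X
    using R(3)[OF U[OF that]] .
  have lin': "linear_on s S s S (\<pi> (bdiag h (1\<^sub>m n)))" if "h \<in> carrier (GL m)" for h
    using R(3)[OF BL[OF that]] .
  have S'_subspace: "subspace S'"
  proof (rule subspaceI)
    show "0 \<in> S'"
      unfolding S'_def using \<open>0 \<in> S\<close> lin lin' by (auto simp: linear_on_def) (metis scale_zero_left)+
    show "x + y \<in> S'" if "x \<in> S'" "y \<in> S'" for x y
      using that lin lin' subspace_add[OF R(2)] by (auto simp: S'_def linear_on_def)
    show "s c x \<in> S'" if "x \<in> S'" for c x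
      using that lin lin' subspace_scale[OF R(2)] by (auto simp: S'_def linear_on_def)
  qed
  have "is_representation (GL n) s S' \<rho>"
    unfolding is_representation_def
  proof (intro conjI ballI)
    show "linear_on s S' s S' (\<rho> h)" if "h \<in> carrier (GL n)" for h
      using R(3)[OF BR[OF that]] \<rho>_closed[OF that] S'_sub
      by (auto simp: linear_on_def \<rho>_def subset_eq)
    show "\<rho> \<one>\<^bsub>GL n\<^esub> u = u" if "u \<in> S'" for u
      using R(5)[of u] that S'_sub by (auto simp: \<rho>_def bdiag_one)
    show "\<rho> (g \<otimes>\<^bsub>GL n\<^esub> h) u = \<rho> g (\<rho> h u)"
      if "g \<in> carrier (GL n)" "h \<in> carrier (GL n)" "u \<in> S'" for g h u
      using R(6)[OF BR[OF that(1)] BR[OF that(2)], of u] that S'_sub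
      by (auto simp: \<rho>_def bdiag_mult[of _ m _ _ n] GL_carrier_mat)
  qed (use S'_subspace R(1) in auto)
  from IH[OF this S'_nz] obtain u where u: "u \<in> S'" "u \<noteq> 0"
    and van: "vanishes_on_singular s n \<psi> (\<lambda>h. \<rho> h u)" by blast
  have uS: "u \<in> S" using u S'_sub by blast
  have "vanishes_on_singular s (m + n) \<psi> (\<lambda>g. \<pi> g u)"
  proof (rule vanishes_on_singular_two_blocks[OF R(1) \<psi>])
    fix g :: "'k mat" assume g: "g \<in> carrier (GL (m + n))"
    show "\<pi> (g * unip m n X) u = \<pi> g u" if "X \<in> carrier_mat m n" for X
      using R(6)[OF g U[OF that] uS] u that by (simp add: S'_def)
    have L: "\<pi> (g * bdiag h (1\<^sub>m n)) u = \<pi> g u" if "h \<in> carrier (GL m)" for h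
      using R(6)[OF g BL[OF that] uS] u that by (simp add: S'_def)
    show "vanishes_on_singular s m \<psi> (\<lambda>h. \<pi> (g * bdiag h (1\<^sub>m n)) u)"
      unfolding vanishes_on_singular_def
    proof (intro ballI impI)
      fix b :: "'k mat" assume "b \<in> carrier_mat m m" "det b = 0"
      then have b: "b = 0\<^sub>m m m" unfolding m by (rule singular_1)
      \<comment> \<open>The summand is constant, so the sum is the order q - 1 of
        \<open>GL 1\<close> times a vector.\<close>
      have "gl_fourier s m \<psi> (\<lambda>h. \<pi> (g * bdiag h (1\<^sub>m n)) u) b =
        (\<Sum>h\<in>(carrier (GL m) :: 'k mat set). s 1 (\<pi> g u))"
        unfolding b gl_fourier_zero[OF \<psi> R(1)] by (rule sum.cong[OF refl]) (simp add: L)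
      also have "\<dots> = s (of_nat (card (carrier (GL m) :: 'k mat set))) (\<pi> g u)"
        unfolding scale_sum_left[symmetric] by simp
      also have "\<dots> = 0" unfolding m card_GL_1 q by simp
      finally show "gl_fourier s m \<psi> (\<lambda>h. \<pi> (g * bdiag h (1\<^sub>m n)) u) b = 0" .
    qed
    show "vanishes_on_singular s n \<psi> (\<lambda>h. \<pi> (g * bdiag (1\<^sub>m m) h) u)"
      unfolding vanishes_on_singular_def
    proof (intro ballI impI)
      fix b :: "'k mat" assume b: "b \<in> carrier_mat n n" "det b = 0"
      \<comment> \<open>The lower factor acts through \<open>\<rho>\<close>, and the outer operator
        \<open>\<pi> g\<close> comes out of the sum, leaving a coefficient that vanishes by the
        choice of \<open>u\<close>.\<close>
      have "gl_fourier s n \<psi> (\<lambda>h. \<pi> (g * bdiag (1\<^sub>m m) h) u) b = gl_fourier s n \<psi> (\<lambda>h. \<pi> g (\<rho> h u)) b"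
        unfolding gl_fourier_def \<rho>_def by (rule sum.cong[OF refl]) (simp add: R(6)[OF g BR uS])
      also have "\<dots> = \<pi> g (gl_fourier s n \<psi> (\<lambda>h. \<rho> h u) b)"
        using R(1-3) g \<rho>_closed u S'_sub by (intro linear_on_gl_fourier[symmetric]) auto
      also have "gl_fourier s n \<psi> (\<lambda>h. \<rho> h u) b = 0"
        using vanishes_on_singularD[OF van b] .
      also have "\<pi> g 0 = 0"
        using R(3)[OF g] \<open>0 \<in> S\<close> by (metis linear_on_def scale_zero_left)
      finally show "gl_fourier s n \<psi> (\<lambda>h. \<pi> (g * bdiag (1\<^sub>m m) h) u) b = 0" .
    qed
  qed
  with contra uS u(2) show False by blast
qed

text \<open>Induction on the rank. The induction hypothesis is applied to a space of fixed vectors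
  inside \<open>S\<close>, which is why the claim is about representations on arbitrary subspaces
  \<open>S\<close>.\<close>

lemma exists_vanishing_vector:
  fixes s :: "'r::field \<Rightarrow> 'v::ab_group_add \<Rightarrow> 'v" and \<pi> :: "'k::{field,finite} mat \<Rightarrow> 'v \<Rightarrow> 'v"
  assumes q: "of_nat (CARD('k) - 1) = (0::'r)" and \<psi>: "nontrivial_character \<psi>"
    and "is_representation (GL n) s S \<pi>" "S \<noteq> {0}"
  shows "\<exists>v\<in>S. v \<noteq> 0 \<and> vanishes_on_singular s n \<psi> (\<lambda>g. \<pi> g v)"
  using assms(3-)
proof (induction n arbitrary: S \<pi>)
  case 0
  interpret vector_space s using representationD(1)[OF 0(1)] .
  have "0 \<in> S" using subspace_0[OF representationD(2)[OF 0(1)]] .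
  with 0(2) obtain v where "v \<in> S" "v \<noteq> 0" by blast
  \<comment> \<open>The determinant of the empty matrix is 1, so there is no singular matrix of size
    0.\<close>
  moreover have "vanishes_on_singular s 0 \<psi> (\<lambda>g. \<pi> g v)"
    by (auto simp: vanishes_on_singular_def det_dim_zero)
  ultimately show ?case by blast
next
  case (Suc n)
  show ?case
    \<comment> \<open>The matrices are cut into blocks of sizes 1 and \<open>n\<close>.\<close>
    unfolding Suc_eq_plus1_left
    by (rule exists_vanishing_vector_step[OF q \<psi> refl _ Suc.prems(2) Suc.IH])
      (use Suc.prems(1) in \<open>simp_all\<close>)
qed

section \<open>Irreducible representations and functional equations\<close>

text \<open>Inverse transpose is an automorphism of the group, and this is the twist of
  \<open>\<pi>\<close> by it, on the same space \<open>V\<close>. It turns the sums over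
  \<open>\<pi> g\<close> treated so far into sums over \<open>\<pi> (inv g)\<close>, up to
  transposing \<open>a\<close>.\<close>

lemma representation_contragredient:
  fixes \<pi> :: "'k::field mat \<Rightarrow> 'v::ab_group_add \<Rightarrow> 'v"
  assumes rep: "is_representation (GL n) s V \<pi>"
  shows "is_representation (GL n) s V (\<lambda>g. \<pi> (inv\<^bsub>GL n\<^esub> g\<^sup>T))"
  unfolding is_representation_def
proof (intro conjI ballI)
  note R = representationD[OF rep]
  show "linear_on s V s V (\<pi> (inv\<^bsub>GL n\<^esub> g\<^sup>T))" if "g \<in> carrier (GL n)" for g
    using that by (intro R(3) GL_inv_closed GL_transpose)
  show "\<pi> (inv\<^bsub>GL n\<^esub> (\<one>\<^bsub>GL n\<^esub>)\<^sup>T) v = v" if "v \<in> V" for v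
    using R(5)[OF that] by (simp add: GL_inv_one)
  show "\<pi> (inv\<^bsub>GL n\<^esub> (g \<otimes>\<^bsub>GL n\<^esub> h)\<^sup>T) v = \<pi> (inv\<^bsub>GL n\<^esub> g\<^sup>T) (\<pi> (inv\<^bsub>GL n\<^esub> h\<^sup>T) v)"
    if gh: "g \<in> carrier (GL n)" "h \<in> carrier (GL n)" and v: "v \<in> V" for g h v
    using R(6)[OF GL_inv_closed[OF GL_transpose[OF gh(1)]] GL_inv_closed[OF GL_transpose[OF gh(2)]] v]
      transpose_mult[OF GL_carrier_mat[OF gh(1)] GL_carrier_mat[OF gh(2)]]
      GL_inv_mult[OF GL_transpose[OF gh(2)] GL_transpose[OF gh(1)]] by simp
qed (use representationD[OF rep] in auto)

text \<open>The trace is invariant under transposition and under swapping two factors.\<close>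

lemma gl_fourier_transpose:
  assumes a: "a \<in> carrier_mat n n"
  shows "gl_fourier s n \<psi> (\<lambda>g. f g\<^sup>T) a = gl_fourier s n \<psi> f a\<^sup>T"
proof -
  have "mtrace (a\<^sup>T * g\<^sup>T) = mtrace (a * g)" if "g \<in> carrier (GL n)" for g
  proof -
    have "mtrace (a * g) = mtrace (g * a)"
      using a GL_carrier_mat[OF that] by (rule mtrace_comm)
    also have "\<dots> = mtrace ((g * a)\<^sup>T)"
      using a GL_carrier_mat[OF that] by (intro mtrace_transpose[symmetric]) auto
    finally show ?thesis
      using a GL_carrier_mat[OF that] by (simp add: transpose_mult[of _ n n _ n])
  qed
  then show ?thesis
    unfolding gl_fourier_def
    by (subst (2) sum.reindex_bij_betw[OF bij_betw_GL_transpose, symmetric]) (auto intro!: sum.cong)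
qed

text \<open>The factor \<open>u\<close> is absorbed into the summation variable. This reduces
  invertible arguments to the identity matrix, and it makes the vanishing of all singular
  coefficients a condition stable under the group, as \<open>a * u\<close> is singular with
  \<open>a\<close>.\<close>

lemma gl_fourier_inv_translate:
  fixes \<pi> :: "'k::field mat \<Rightarrow> 'v::ab_group_add \<Rightarrow> 'v"
  assumes rep: "is_representation (GL n) s V \<pi>"
    and u: "u \<in> carrier (GL n)" and a: "a \<in> carrier_mat n n" and v: "v \<in> V"
  shows "gl_fourier s n \<psi> (\<lambda>g. \<pi> (inv\<^bsub>GL n\<^esub> g) (\<pi> u v)) a =
    gl_fourier s n \<psi> (\<lambda>g. \<pi> (inv\<^bsub>GL n\<^esub> g) v) (a * u)"
proof -
  have "gl_fourier s n \<psi> (\<lambda>g. \<pi> (inv\<^bsub>GL n\<^esub> g) (\<pi> u v)) a =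
    gl_fourier s n \<psi> (\<lambda>g. \<pi> (inv\<^bsub>GL n\<^esub> (inv\<^bsub>GL n\<^esub> u * g)) v) a"
    unfolding gl_fourier_def using representationD(6)[OF rep _ u v] u
    by (intro sum.cong) (auto simp: GL_inv_mult GL_inv_inv GL_inv_closed)
  also have "\<dots> = gl_fourier s n \<psi> (\<lambda>g. \<pi> (inv\<^bsub>GL n\<^esub> g) v) (a * u)"
    using gl_fourier_translate_left[OF GL_inv_closed[OF u] a, of s \<psi> "\<lambda>g. \<pi> (inv\<^bsub>GL n\<^esub> g) v"]
    by (simp add: GL_inv_inv[OF u])
  finally show ?thesis .
qed

lemma irreducible_UNIV:
  assumes "irreducible_rep (GL n) s UNIV \<pi>" "module.subspace s W"
    "\<And>g v. g \<in> carrier (GL n) \<Longrightarrow> v \<in> W \<Longrightarrow> \<pi> g v \<in> W" "w \<in> W" "w \<noteq> 0"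
  shows "W = UNIV"
  using assms by (auto simp: irreducible_rep_def image_subset_iff)

lemma linear_on_gl_fourier_family:
  fixes A :: "'k::{field,finite} mat \<Rightarrow> 'v::ab_group_add \<Rightarrow> 'v"
  assumes vs: "vector_space s" and V: "module.subspace s V"
    and A: "\<And>g. g \<in> carrier (GL n) \<Longrightarrow> linear_on s V s V (A g)"
  shows "linear_on s V s V (\<lambda>v. gl_fourier s n \<psi> (\<lambda>g. A g v) a)"
proof -
  interpret vector_space s by (rule vs)
  have A': "A g x \<in> V" "A g (x + y) = A g x + A g y" "A g (s c x) = s c (A g x)"
    if "g \<in> carrier (GL n)" "x \<in> V" "y \<in> V" for g x y c
    using A[OF that(1)] that(2,3) by (auto simp: linear_on_def)
  show ?thesis
    unfolding linear_on_def
  proof (intro conjI ballI allI)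
    show "(\<lambda>v. gl_fourier s n \<psi> (\<lambda>g. A g v) a) ` V \<subseteq> V"
      by (auto intro!: gl_fourier_in_subspace[OF vs V] intro: A'(1))
    show "gl_fourier s n \<psi> (\<lambda>g. A g (x + y)) a =
      gl_fourier s n \<psi> (\<lambda>g. A g x) a + gl_fourier s n \<psi> (\<lambda>g. A g y) a" if "x \<in> V" "y \<in> V" for x y
      by (simp add: gl_fourier_def A' that scale_right_distrib sum.distrib)
    show "gl_fourier s n \<psi> (\<lambda>g. A g (s c x)) a = s c (gl_fourier s n \<psi> (\<lambda>g. A g x) a)"
      if "x \<in> V" for c x
      by (simp add: gl_fourier_def A'(3)[OF _ that that] scale_sum_right mult.commute[of c])
  qed
qed

lemma linear_gl_fourier:
  fixes A :: "'k::{field,finite} mat \<Rightarrow> 'v::ab_group_add \<Rightarrow> 'v"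
  assumes vs: "vector_space s" and A: "\<And>g. g \<in> carrier (GL n) \<Longrightarrow> linear_on s UNIV s UNIV (A g)"
  shows "Vector_Spaces.linear s s (\<lambda>v. gl_fourier s n \<psi> (\<lambda>g. A g v) a)"
proof -
  interpret vector_space s by (rule vs)
  have "linear_on s UNIV s UNIV (\<lambda>v. gl_fourier s n \<psi> (\<lambda>g. A g v) a)"
    using vs subspace_UNIV A by (rule linear_on_gl_fourier_family)
  then show ?thesis
    using vs by (simp add: linear_on_def Vector_Spaces.linear_iff)
qed

text \<open>The vectors on which all singular coefficients vanish form a subrepresentation, which is
  nonzero by \<open>exists_vanishing_vector\<close>.\<close>

lemma irreducible_vanishes_on_singular:
  fixes s :: "'r::field \<Rightarrow> 'v::ab_group_add \<Rightarrow> 'v" and \<pi> :: "'k::{field,finite} mat \<Rightarrow> 'v \<Rightarrow> 'v"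
  assumes q: "of_nat (CARD('k) - 1) = (0::'r)" and \<psi>: "nontrivial_character \<psi>"
    and irr: "irreducible_rep (GL n) s UNIV \<pi>"
  shows "vanishes_on_singular s n \<psi> (\<lambda>g. \<pi> (inv\<^bsub>GL n\<^esub> g) v)"
proof -
  have rep: "is_representation (GL n) s UNIV \<pi>" and nz: "(UNIV :: 'v set) \<noteq> {0}"
    using irr by (auto simp: irreducible_rep_def)
  note R = representationD[OF rep]
  interpret vector_space s by (rule R(1))
  obtain w where w: "w \<noteq> 0" and "vanishes_on_singular s n \<psi> (\<lambda>g. \<pi> (inv\<^bsub>GL n\<^esub> g\<^sup>T) w)"
    using exists_vanishing_vector[OF q \<psi> representation_contragredient[OF rep] nz] by blast
  \<comment> \<open>Transposing both the group variable and \<open>a\<close> undoes the twist; the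
    transpose of a singular matrix is singular.\<close>
  then have w_van: "gl_fourier s n \<psi> (\<lambda>g. \<pi> (inv\<^bsub>GL n\<^esub> g) w) a = 0"
    if "a \<in> carrier_mat n n" "det a = 0" for a
    using that gl_fourier_transpose[of "a\<^sup>T" n s \<psi> "\<lambda>g. \<pi> (inv\<^bsub>GL n\<^esub> g) w"]
    by (auto simp: vanishes_on_singular_def det_transpose)
  define W where "W = {u. vanishes_on_singular s n \<psi> (\<lambda>g. \<pi> (inv\<^bsub>GL n\<^esub> g) u)}"
  have lin: "Vector_Spaces.linear s s (\<lambda>u. gl_fourier s n \<psi> (\<lambda>g. \<pi> (inv\<^bsub>GL n\<^esub> g) u) a)" for a
    using R(1) R(3)[OF GL_inv_closed] by (rule linear_gl_fourier)
  note lin_simps = module_hom.zero[OF module_hom_linearI[OF lin]]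
    module_hom.add[OF module_hom_linearI[OF lin]] module_hom.scale[OF module_hom_linearI[OF lin]]
  have "W = UNIV"
  proof (rule irreducible_UNIV[OF irr])
    show "subspace W"
      by (rule subspaceI) (auto simp: W_def vanishes_on_singular_def lin_simps)
    show "\<pi> g u \<in> W" if "g \<in> carrier (GL n)" "u \<in> W" for g u
      using that gl_fourier_inv_translate[OF rep that(1)] GL_carrier_mat[OF that(1)]
      by (auto simp: W_def vanishes_on_singular_def det_mult)
    show "w \<in> W" by (simp add: W_def vanishes_on_singular_def w_van)
  qed (rule w)
  then show ?thesis by (auto simp: W_def)
qed

text \<open>More than \<open>card B\<close> vectors in the span of \<open>B\<close> satisfy a linear
  relation. Its coefficients are packed into a polynomial so that, for
  \<open>x i = (T ^^ i) v\<close>, the relation reads p(T) v = 0.\<close>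

lemma (in vector_space) family_dependent:
  fixes x :: "nat \<Rightarrow> 'b"
  assumes "finite B" "\<And>i. x i \<in> span B"
  shows "\<exists>p :: 'a poly. p \<noteq> 0 \<and> (\<Sum>i\<le>degree p. coeff p i *s x i) = 0"
proof -
  define N where "N = card B"
  have "\<exists>c :: nat \<Rightarrow> 'a. (\<exists>i\<le>N. c i \<noteq> 0) \<and> (\<Sum>i\<le>N. c i *s x i) = 0"
  proof (cases "inj_on x {..N}")
    case False
    then obtain i j where ij: "i \<le> N" "j \<le> N" "i \<noteq> j" "x i = x j" by (auto simp: inj_on_def)
    \<comment> \<open>A repeated vector gives the relation \<open>x i - x j = 0\<close>.\<close>
    let ?c = "\<lambda>k. (if k = i then 1 else 0) - (if k = j then 1 else (0::'a))"
    have "(\<Sum>k\<le>N. ?c k *s x k) = (\<Sum>k\<le>N. (if k = i then x k else 0) - (if k = j then x k else 0))"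
      by (intro sum.cong) (auto simp: scale_left_diff_distrib)
    also have "\<dots> = 0" using ij by (simp add: sum_subtractf)
    finally show ?thesis using ij by (intro exI[of _ ?c]) auto
  next
    case True
    have "dependent (x ` {..N})"
    proof (rule ccontr)
      assume "independent (x ` {..N})"
      from independent_span_bound[OF assms(1) this] assms(2)
      have "card (x ` {..N}) \<le> N" by (auto simp: N_def)
      with True show False by (simp add: card_image)
    qed
    then obtain u v where v: "v \<in> x ` {..N}" "u v \<noteq> 0" "(\<Sum>v\<in>x ` {..N}. u v *s v) = 0"
      using dependent_finite[of "x ` {..N}"] by auto
    then show ?thesis
      using True by (intro exI[of _ "u \<circ> x"]) (auto simp: sum.reindex)
  qed
  then obtain c where c: "\<exists>i\<le>N. c i \<noteq> 0" "(\<Sum>i\<le>N. c i *s x i) = 0" by blast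
  define p where "p = (\<Sum>i\<le>N. monom (c i) i)"
  have cp: "coeff p i = (if i \<le> N then c i else 0)" for i
    by (simp add: p_def coeff_sum)
  have "p \<noteq> 0" using c(1) cp by (metis coeff_0)
  moreover have "(\<Sum>i\<le>degree p. coeff p i *s x i) = (\<Sum>i\<le>N. coeff p i *s x i)"
  proof (rule sum.mono_neutral_left)
    show "{..degree p} \<subseteq> {..N}"
      using degree_le[of N p] cp by auto
  qed (auto simp: coeff_eq_0)
  ultimately show ?thesis using c(2) cp by (intro exI[of _ p]) simp
qed

text \<open>With p = (X - c) q, either \<open>v\<close> is an eigenvector for \<open>c\<close>, or
  \<open>T v - c *s v\<close> is a nonzero vector killed by q(T), and q has smaller degree.\<close>

lemma (in vector_space) linear_poly_kernel:
  fixes p :: "'a poly"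
  assumes T: "Vector_Spaces.linear scale scale T" and ac: "\<And>q :: 'a poly. degree q > 0 \<Longrightarrow> \<exists>c. poly q c = 0"
  shows "p \<noteq> 0 \<Longrightarrow> v \<noteq> 0 \<Longrightarrow> (\<Sum>i\<le>degree p. coeff p i *s (T ^^ i) v) = 0 \<Longrightarrow>
    \<exists>w c. w \<noteq> 0 \<and> T w = c *s w"
proof (induction "degree p" arbitrary: p v)
  case 0
  \<comment> \<open>A nonzero constant cannot kill the nonzero vector \<open>v\<close>.\<close>
  then show ?case by (metis (no_types) atMost_0 coeff_0 finite.emptyI funpow_0 leading_coeff_0_iff
        scale_eq_0_iff sum.empty sum.insert add.right_neutral empty_iff)
next
  case (Suc d)
  then obtain c where "poly p c = 0" using ac[of p] by auto
  then obtain q where q: "p = [:- c, 1:] * q" by (metis dvdE poly_eq_0_iff_dvd)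
  have "q \<noteq> 0" using Suc.prems(1) q by auto
  have dp: "degree p = Suc (degree q)" unfolding q using \<open>q \<noteq> 0\<close> by (subst degree_mult_eq) auto
  interpret T: Vector_Spaces.linear scale scale T by (rule T)
  let ?w = "T v - c *s v"
  show ?case
  proof (cases "?w = 0")
    case True
    with Suc.prems(2) show ?thesis by auto
  next
    case False
    have Tn: "(T ^^ i) (x - y) = (T ^^ i) x - (T ^^ i) y" "(T ^^ i) (a *s x) = a *s (T ^^ i) x" for i x y a
      by (induction i) (auto simp: T.diff T.scale)
    \<comment> \<open>Expands q(T) (T - c) v; multiplication by X becomes the shift
      \<open>pCons 0 q\<close>, and both sums are brought to the range belonging to
      \<open>p\<close>.\<close>
    have "(\<Sum>i\<le>degree q. coeff q i *s (T ^^ i) ?w) =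
      (\<Sum>i\<le>degree q. coeff q i *s (T ^^ Suc i) v) - (\<Sum>i\<le>degree q. (c * coeff q i) *s (T ^^ i) v)"
      by (simp add: Tn scale_right_diff_distrib sum_subtractf funpow_swap1 mult.commute)
    also have "(\<Sum>i\<le>degree q. coeff q i *s (T ^^ Suc i) v) =
      (\<Sum>i\<le>degree p. coeff (pCons 0 q) i *s (T ^^ i) v)"
      unfolding dp by (subst sum.atMost_Suc_shift) simp
    also have "(\<Sum>i\<le>degree q. (c * coeff q i) *s (T ^^ i) v) =
      (\<Sum>i\<le>degree p. (c * coeff q i) *s (T ^^ i) v)"
      unfolding dp by (simp add: coeff_eq_0)
    also have "(\<Sum>i\<le>degree p. coeff (pCons 0 q) i *s (T ^^ i) v) - \<dots> =
      (\<Sum>i\<le>degree p. coeff p i *s (T ^^ i) v)"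
      unfolding q by (simp add: sum_subtractf[symmetric] scale_left_diff_distrib[symmetric])
    finally have "(\<Sum>i\<le>degree q. coeff q i *s (T ^^ i) ?w) = 0" using Suc.prems(3) by simp
    moreover have "d = degree q" using Suc.hyps(2) dp by simp
    ultimately show ?thesis using Suc.hyps(1)[OF _ \<open>q \<noteq> 0\<close> False] by blast
  qed
qed

text \<open>The orbit of a nonzero vector is finite and spans, so the iterates of \<open>T\<close>
  on that vector are dependent and \<open>T\<close> has an eigenvector; its eigenspace is stable
  under the group, hence everything. Finite dimension is supplied by the finiteness of the
  group.\<close>

lemma schur_scalar:
  fixes s :: "'r::alg_closed_field \<Rightarrow> 'v::ab_group_add \<Rightarrow> 'v" and \<pi> :: "'k::{field,finite} mat \<Rightarrow> 'v \<Rightarrow> 'v"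
  assumes irr: "irreducible_rep (GL n) s UNIV \<pi>" and T: "Vector_Spaces.linear s s T"
    and comm: "\<And>g v. g \<in> carrier (GL n) \<Longrightarrow> T (\<pi> g v) = \<pi> g (T v)"
  shows "\<exists>c. \<forall>v. T v = s c v"
proof -
  have rep: "is_representation (GL n) s UNIV \<pi>" and nz: "(UNIV :: 'v set) \<noteq> {0}"
    using irr by (auto simp: irreducible_rep_def)
  note R = representationD[OF rep]
  interpret vector_space s by (rule R(1))
  interpret T: Vector_Spaces.linear s s T by (rule T)
  obtain v :: 'v where v: "v \<noteq> 0" using nz by blast
  define B where "B = (\<lambda>g. \<pi> g v) ` carrier (GL n)"
  have "finite B" by (simp add: B_def finite_GL)
  have "span B = UNIV"
  proof (rule irreducible_UNIV[OF irr subspace_span])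
    show "v \<in> span B"
      using R(5)[of v] GL_one_closed[of n] by (intro span_base) (auto simp: B_def intro!: image_eqI)
    show "\<pi> g u \<in> span B" if g: "g \<in> carrier (GL n)" and u: "u \<in> span B" for g u
      using u
    proof (induction rule: span_induct_alt)
      case base
      show ?case using R(3)[OF g] span_zero by (metis UNIV_I linear_on_def scale_zero_left)
    next
      case (step c x y)
      from step(1) obtain h where h: "h \<in> carrier (GL n)" "x = \<pi> h v" by (auto simp: B_def)
      have "\<pi> g x \<in> span B"
        unfolding h(2) R(6)[OF g h(1) UNIV_I, symmetric] B_def
        using GL_mult_closed[OF g h(1)] by (intro span_base imageI)
      moreover have "\<pi> g (s c x + y) = s c (\<pi> g x) + \<pi> g y"
        using R(3)[OF g] by (simp add: linear_on_def)
      ultimately show ?case using step(2) by (simp add: span_add span_scale)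
    qed
  qed (rule v)
  then obtain p :: "'r poly" where "p \<noteq> 0" "(\<Sum>i\<le>degree p. s (coeff p i) ((T ^^ i) v)) = 0"
    using family_dependent[OF \<open>finite B\<close>, of "\<lambda>i. (T ^^ i) v"] by auto
  then obtain w c where w: "w \<noteq> 0" "T w = s c w"
    using linear_poly_kernel[OF T alg_closed_imp_poly_has_root _ v] by blast
  have "{u. T u = s c u} = UNIV"
  proof (rule irreducible_UNIV[OF irr])
    show "subspace {u. T u = s c u}"
      by (rule subspaceI) (auto simp: T.add T.scale scale_right_distrib scale_left_commute)
    show "\<pi> g u \<in> {u. T u = s c u}" if "g \<in> carrier (GL n)" "u \<in> {u. T u = s c u}" for g u
      using that comm R(3)[OF that(1)] by (simp add: linear_on_def)
  qed (use w in auto)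
  then show ?thesis by blast
qed

text \<open>The coefficient operator \<open>T\<close> at the identity commutes with
  \<open>\<pi> a\<close>, because both composites equal the coefficient operator at
  \<open>a\<close>: one by absorbing \<open>a\<close> into the group variable, the other by
  cyclicity of the trace. The scalar given by Schur's lemma serves for every
  \<open>a\<close>.\<close>

lemma gl_fourier_inv_scalar:
  fixes s :: "'r::alg_closed_field \<Rightarrow> 'v::ab_group_add \<Rightarrow> 'v" and \<pi> :: "'k::{field,finite} mat \<Rightarrow> 'v \<Rightarrow> 'v"
  assumes irr: "irreducible_rep (GL n) s UNIV \<pi>"
  shows "\<exists>c. \<forall>a\<in>carrier (GL n). \<forall>v. gl_fourier s n \<psi> (\<lambda>g. \<pi> (inv\<^bsub>GL n\<^esub> g) v) a = s c (\<pi> a v)"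
proof -
  have rep: "is_representation (GL n) s UNIV \<pi>"
    using irr by (auto simp: irreducible_rep_def)
  note R = representationD[OF rep]
  interpret vector_space s by (rule R(1))
  define T where "T v = gl_fourier s n \<psi> (\<lambda>g. \<pi> (inv\<^bsub>GL n\<^esub> g) v) (1\<^sub>m n)" for v
  have T: "Vector_Spaces.linear s s T"
    unfolding T_def using R(1) R(3)[OF GL_inv_closed] by (rule linear_gl_fourier)
  have Ta: "T (\<pi> a v) = gl_fourier s n \<psi> (\<lambda>g. \<pi> (inv\<^bsub>GL n\<^esub> g) v) a" if "a \<in> carrier (GL n)" for a v
    using gl_fourier_inv_translate[OF rep that, of "1\<^sub>m n" v \<psi>] GL_carrier_mat[OF that]
    by (simp add: T_def)
  have comm: "T (\<pi> a v) = \<pi> a (T v)" if a: "a \<in> carrier (GL n)" for a v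
  proof -
    have "\<pi> a (T v) = gl_fourier s n \<psi> (\<lambda>g. \<pi> a (\<pi> (inv\<^bsub>GL n\<^esub> g) v)) (1\<^sub>m n)"
      unfolding T_def using R(1,2) R(3)[OF a] by (intro linear_on_gl_fourier) auto
    also have "\<dots> = gl_fourier s n \<psi> (\<lambda>g. \<pi> (inv\<^bsub>GL n\<^esub> (g * inv\<^bsub>GL n\<^esub> a)) v) (1\<^sub>m n)"
      unfolding gl_fourier_def using a R(6)[OF a GL_inv_closed, of _ v]
      by (intro sum.cong) (auto simp: GL_inv_mult GL_inv_inv GL_inv_closed)
    also have "\<dots> = gl_fourier s n \<psi> (\<lambda>g. \<pi> (inv\<^bsub>GL n\<^esub> g) v) a"
      using gl_fourier_translate_right[OF GL_inv_closed[OF a], of "1\<^sub>m n" s \<psi> "\<lambda>g. \<pi> (inv\<^bsub>GL n\<^esub> g) v"]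
        GL_carrier_mat[OF a] by (simp add: GL_inv_inv[OF a])
    finally show ?thesis using Ta[OF a] by simp
  qed
  obtain c where c: "\<And>v. T v = s c v"
    using schur_scalar[OF irr T comm] by blast
  with Ta show ?thesis by metis
qed

text \<open>Exchanging the two sums turns the left side into a sum over all matrices
  \<open>a\<close> of \<open>\<Phi> a\<close> against the coefficient at \<open>a\<close>; only
  invertible \<open>a\<close> survive. The disjunction covers both the weak equation, where
  \<open>\<Phi>\<close> vanishes on singular matrices, and the full one, where the coefficients
  do.\<close>

lemma functional_equation_if_vanishing:
  fixes s :: "'r::field \<Rightarrow> 'v::ab_group_add \<Rightarrow> 'v" and \<pi> :: "'k::{field,finite} mat \<Rightarrow> 'v \<Rightarrow> 'v"
  assumes c: "\<And>a v. a \<in> carrier (GL n) \<Longrightarrow>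
      gl_fourier s n \<psi> (\<lambda>g. \<pi> (inv\<^bsub>GL n\<^esub> g) v) a = s c (\<pi> a v)"
    and sing: "\<And>a v. a \<in> carrier_mat n n - carrier (GL n) \<Longrightarrow>
      \<Phi> a = 0 \<or> gl_fourier s n \<psi> (\<lambda>g. \<pi> (inv\<^bsub>GL n\<^esub> g) v) a = 0"
  shows "functional_equation r n s \<pi> \<psi> (inverse (r ^ n\<^sup>2) * c) \<Phi>"
  unfolding functional_equation_def
proof (intro allI impI)
  fix v v' assume v': "Vector_Spaces.linear s (*) v'"
  note hom = module_hom_linearI[OF v']
  let ?i = "inverse (r ^ n\<^sup>2)"
  let ?F = "\<lambda>a. v' (gl_fourier s n \<psi> (\<lambda>g. \<pi> (inv\<^bsub>GL n\<^esub> g) v) a)"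
  have "(\<Sum>g\<in>carrier (GL n). fourier r n \<psi> \<Phi> g * v' (\<pi> (inv\<^bsub>GL n\<^esub> g) v)) =
    (\<Sum>g\<in>carrier (GL n). \<Sum>a\<in>carrier_mat n n. ?i * \<Phi> a * (\<psi> (mtrace (a * g)) * v' (\<pi> (inv\<^bsub>GL n\<^esub> g) v)))"
    by (simp add: fourier_def sum_distrib_left sum_distrib_right mult.assoc)
  also have "\<dots> = (\<Sum>a\<in>carrier_mat n n. ?i * \<Phi> a * ?F a)"
    by (subst sum.swap) (simp add: gl_fourier_def module_hom.sum[OF hom] module_hom.scale[OF hom] sum_distrib_left)
  also have "\<dots> = (\<Sum>a\<in>carrier (GL n). ?i * \<Phi> a * ?F a)"
  proof (rule sum.mono_neutral_right)
    show "\<forall>a\<in>carrier_mat n n - carrier (GL n). ?i * \<Phi> a * ?F a = 0"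
      using sing[of _ v] module_hom.zero[OF hom] by fastforce
  qed (auto simp: finite_carrier_mat GL_carrier_mat)
  also have "\<dots> = (?i * c) * (\<Sum>a\<in>carrier (GL n). \<Phi> a * v' (\<pi> a v))"
    unfolding sum_distrib_left by (rule sum.cong) (simp_all add: c module_hom.scale[OF hom])
  finally show "(\<Sum>g\<in>carrier (GL n). fourier r n \<psi> \<Phi> g * v' (\<pi> (inv\<^bsub>GL n\<^esub> g) v)) =
    (?i * c) * (\<Sum>a\<in>carrier (GL n). \<Phi> a * v' (\<pi> a v))" .
qed

lemma irreducible_WGJFE:
  fixes s :: "'r::alg_closed_field \<Rightarrow> 'v::ab_group_add \<Rightarrow> 'v" and \<pi> :: "'k::{field,finite} mat \<Rightarrow> 'v \<Rightarrow> 'v"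
  assumes irr: "irreducible_rep (GL n) s UNIV \<pi>"
  shows "WGJFE r n s \<pi>"
  unfolding WGJFE_def
proof (intro allI impI)
  fix \<psi> :: "'k \<Rightarrow> 'r"
  obtain c where c: "\<And>a v. a \<in> carrier (GL n) \<Longrightarrow>
      gl_fourier s n \<psi> (\<lambda>g. \<pi> (inv\<^bsub>GL n\<^esub> g) v) a = s c (\<pi> a v)"
    using gl_fourier_inv_scalar[OF irr, of \<psi>] by blast
  show "\<exists>\<gamma>. \<forall>\<Phi>. (\<forall>g\<in>carrier_mat n n - carrier (GL n). \<Phi> g = 0) \<longrightarrow> functional_equation r n s \<pi> \<psi> \<gamma> \<Phi>"
    by (rule exI[of _ "inverse (r ^ n\<^sup>2) * c"])
      (intro allI impI functional_equation_if_vanishing[OF c], auto)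
qed

lemma irreducible_GJFE:
  fixes s :: "'r::alg_closed_field \<Rightarrow> 'v::ab_group_add \<Rightarrow> 'v" and \<pi> :: "'k::{field,finite} mat \<Rightarrow> 'v \<Rightarrow> 'v"
  assumes irr: "irreducible_rep (GL n) s UNIV \<pi>"
    and van: "\<And>\<psi> v. nontrivial_character \<psi> \<Longrightarrow>
      vanishes_on_singular s n \<psi> (\<lambda>g. \<pi> (inv\<^bsub>GL n\<^esub> g) v)"
  shows "GJFE r n s \<pi>"
  unfolding GJFE_def
proof (intro allI impI)
  fix \<psi> :: "'k \<Rightarrow> 'r" assume \<psi>: "nontrivial_character \<psi>"
  obtain c where c: "\<And>a v. a \<in> carrier (GL n) \<Longrightarrow>
      gl_fourier s n \<psi> (\<lambda>g. \<pi> (inv\<^bsub>GL n\<^esub> g) v) a = s c (\<pi> a v)"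
    using gl_fourier_inv_scalar[OF irr, of \<psi>] by blast
  show "\<exists>\<gamma>. \<forall>\<Phi>. functional_equation r n s \<pi> \<psi> \<gamma> \<Phi>"
    by (rule exI[of _ "inverse (r ^ n\<^sup>2) * c"])
      (intro allI functional_equation_if_vanishing[OF c],
        auto simp: carrier_GL intro!: vanishes_on_singularD[OF van[OF \<psi>]])
qed

section \<open>Cuspidal representations\<close>

text \<open>Provides the shape required by \<open>mult_eq_if_col_0\<close>: below the first row, the
  first column is cleared by the parabolic condition, and the rest is the second diagonal
  block.\<close>

lemma std_unipotent_radical_1_entry:
  assumes u: "u \<in> std_unipotent_radical [1, l]" and ij: "0 < i" "i < Suc l" "j < Suc l"
  shows "u $$ (i, j) = 1\<^sub>m (Suc l) $$ (i, j)"
proof (cases "j = 0")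
  case True
  have "\<forall>j<length [1, l]. \<forall>a b. offset [1, l] j \<le> a \<and> a < sum_list [1, l] \<and> b < offset [1, l] j
      \<longrightarrow> u $$ (a, b) = 0"
    using u unfolding std_unipotent_radical_def std_parabolic_def by blast
  \<comment> \<open>Block 1 begins at row \<open>offset [1, l] 1 = 1\<close>.\<close>
  from this[rule_format, of 1 i j] have "u $$ (i, j) = 0"
    using ij True by (simp add: offset_def)
  with True ij show ?thesis by simp
next
  case False
  have "diag_block [1, l] 1 u = 1\<^sub>m l"
    using u by (auto simp: std_unipotent_radical_def)
  from arg_cong[OF this, of "\<lambda>M. M $$ (i - 1, j - 1)"] show ?thesis
    using False ij by (auto simp: diag_block_def offset_def)
qed

text \<open>The blocks \<open>[1, l]\<close> with \<open>l > 0\<close> give a proper parabolic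
  subgroup. Conjugating its radical by \<open>k\<close> yields a set \<open>U\<close> with
  \<open>a * h = a\<close> for all \<open>h \<in> U\<close>, so the coefficient operator
  \<open>F\<close> is unchanged by precomposition with \<open>\<rho> h\<close>. It thus vanishes on
  the coinvariant kernel, which is all of \<open>V\<close> by cuspidality.\<close>

lemma cuspidal_vanishes_on_singular:
  fixes s :: "'r::field \<Rightarrow> 'v::ab_group_add \<Rightarrow> 'v" and \<rho> :: "'k::{field,finite} mat \<Rightarrow> 'v \<Rightarrow> 'v"
  assumes rep: "is_representation (GL n) s V \<rho>" and cusp: "cuspidal n s V \<rho>" and n: "2 \<le> n"
    and v: "v \<in> V"
  shows "vanishes_on_singular s n \<psi> (\<lambda>g. \<rho> (inv\<^bsub>GL n\<^esub> g) v)"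
  unfolding vanishes_on_singular_def
proof (intro ballI impI)
  fix a :: "'k mat" assume a: "a \<in> carrier_mat n n" "det a = 0"
  note R = representationD[OF rep]
  interpret vector_space s by (rule R(1))
  obtain l where l: "n = Suc l" using n by (cases n) auto
  obtain k where k: "k \<in> carrier (GL n)" and col: "\<And>i. i < n \<Longrightarrow> (a * k) $$ (i, 0) = 0"
    using singular_matrix_col_0[OF a] by blast
  define U where "U = (\<lambda>u. k \<otimes>\<^bsub>GL n\<^esub> u \<otimes>\<^bsub>GL n\<^esub> inv\<^bsub>GL n\<^esub> k) ` std_unipotent_radical [1, l]"
  have "U \<in> proper_unipotent_radicals n"
    unfolding proper_unipotent_radicals_def U_def using k n l
    by (intro CollectI exI[of _ "[1, l]"] exI[of _ k]) (auto simp: composition_def)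
  with cusp have ker: "coinvariant_kernel s V \<rho> U = V" by (auto simp: cuspidal_def)
  have U_closed: "u \<in> carrier (GL n)" if "u \<in> std_unipotent_radical [1, l]" for u :: "'k mat"
    using that l by (simp add: std_unipotent_radical_def std_parabolic_def)
  have fix_a: "h \<in> carrier (GL n) \<and> a * h = a" if h: "h \<in> U" for h
  proof -
    obtain u where u: "u \<in> std_unipotent_radical [1, l]" and hu: "h = k * u * inv\<^bsub>GL n\<^esub> k"
      using h by (auto simp: U_def)
    note c = a(1) GL_carrier_mat[OF k] GL_carrier_mat[OF U_closed[OF u]]
      GL_carrier_mat[OF GL_inv_closed[OF k]]
    \<comment> \<open>\<open>a * k\<close> has zero first column, and \<open>u\<close> agrees with
      the identity below its first row.\<close>
    have aku: "a * k * u = a * k"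
      using c std_unipotent_radical_1_entry[OF u] by (intro mult_eq_if_col_0[of _ n] col) (auto simp: l)
    have "a * h = a * k * u * inv\<^bsub>GL n\<^esub> k"
      using c by (simp add: hu assoc_mult_mat[of _ n n _ n _ n])
    also have "\<dots> = a * k * inv\<^bsub>GL n\<^esub> k" by (simp only: aku)
    also have "\<dots> = a * (k * inv\<^bsub>GL n\<^esub> k)" using c by (simp add: assoc_mult_mat[of _ n n _ n _ n])
    also have "\<dots> = a" unfolding GL_inv_right[OF k] by (rule right_mult_one_mat[OF a(1)])
    finally show ?thesis
      using k U_closed[OF u] by (auto simp: hu intro!: GL_mult_closed GL_inv_closed)
  qed
  define F where "F u = gl_fourier s n \<psi> (\<lambda>g. \<rho> (inv\<^bsub>GL n\<^esub> g) u) a" for u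
  have F: "linear_on s V s V F"
    unfolding F_def using R(1,2) R(3)[OF GL_inv_closed] by (rule linear_on_gl_fourier_family)
  have F_add: "F (x + y) = F x + F y" and F_scale: "F (s c x) = s c (F x)"
    if "x \<in> V" "y \<in> V" for x y c
    using F that by (auto simp: linear_on_def)
  have F_fix: "F (\<rho> h x) = F x" if "h \<in> U" "x \<in> V" for h x
    using gl_fourier_inv_translate[OF rep _ a(1) that(2), of h] fix_a[OF that(1)] by (simp add: F_def)
  have "v \<in> span {\<rho> h x - x | h x. h \<in> U \<and> x \<in> V}"
    using ker v by (simp add: coinvariant_kernel_def)
  \<comment> \<open>Membership in \<open>V\<close> is carried through the induction because
    \<open>F\<close> is known to be additive only there.\<close>
  then have "v \<in> V \<and> F v = 0"
  proof (induction rule: span_induct_alt)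
    case base
    show ?case using F_scale[OF subspace_0[OF R(2)] subspace_0[OF R(2)], of 0] subspace_0[OF R(2)] by simp
  next
    case (step c x y)
    then obtain h z where h: "h \<in> U" "z \<in> V" "x = \<rho> h z - z" by blast
    have hz: "\<rho> h z \<in> V" using R(4) fix_a h by blast
    have x: "x \<in> V" unfolding h(3) using hz h(2) by (rule subspace_diff[OF R(2)])
    have "F x + F z = F z" using F_add[OF x h(2)] F_fix[OF h(1,2)] h(3) by simp
    then have "F x = 0" by simp
    moreover have "s c x \<in> V" using x by (rule subspace_scale[OF R(2)])
    ultimately show ?case
      using step x by (simp add: F_add F_scale subspace_add[OF R(2)])
  qed
  then show "gl_fourier s n \<psi> (\<lambda>g. \<rho> (inv\<^bsub>GL n\<^esub> g) v) a = 0" by (simp add: F_def)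
qed

section \<open>Isomorphism classes and representations of rank one\<close>

lemma intertwiner_comp:
  assumes "intertwiner G s V \<pi> t W \<rho> f" "intertwiner G t W \<rho> u X \<sigma> g"
  shows "intertwiner G s V \<pi> u X \<sigma> (g \<circ> f)"
  using assms unfolding intertwiner_def linear_on_def by (auto simp: image_subset_iff)

lemma intertwiner_inv_into:
  assumes rep: "is_representation (GL n) s V \<pi>"
    and f: "intertwiner (GL n) s V \<pi> t W \<rho> f" and bij: "bij_betw f V W"
  shows "intertwiner (GL n) t W \<rho> s V \<pi> (inv_into V f)"
proof -
  note R = representationD[OF rep]
  interpret vector_space s by (rule R(1))
  let ?i = "inv_into V f"
  have iV: "?i w \<in> V" and fi: "f (?i w) = w" if "w \<in> W" for w
    using that bij by (auto simp: bij_betw_def inv_into_into f_inv_into_f)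
  have ieq: "?i w = v" if "v \<in> V" "f v = w" for v w
    using that bij by (auto simp: bij_betw_def inv_into_f_f)
  have lin: "\<And>x y. x \<in> V \<Longrightarrow> y \<in> V \<Longrightarrow> f (x + y) = f x + f y"
    "\<And>x c. x \<in> V \<Longrightarrow> f (s c x) = t c (f x)"
    using f by (auto simp: intertwiner_def linear_on_def)
  have eqv: "f (\<pi> g x) = \<rho> g (f x)" if "g \<in> carrier (GL n)" "x \<in> V" for g x
    using f that by (auto simp: intertwiner_def)
  show ?thesis
    unfolding intertwiner_def linear_on_def
  proof (intro conjI ballI allI)
    show "?i (x + y) = ?i x + ?i y" if "x \<in> W" "y \<in> W" for x y
      using that by (intro ieq subspace_add[OF R(2)]) (auto simp: iV fi lin)
    show "?i (t c x) = s c (?i x)" if "x \<in> W" for c x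
      using that by (intro ieq subspace_scale[OF R(2)]) (auto simp: iV fi lin)
    show "?i (\<rho> g x) = \<pi> g (?i x)" if "g \<in> carrier (GL n)" "x \<in> W" for g x
      using that by (intro ieq R(4)) (auto simp: iV fi eqv)
  qed (auto simp: iV)
qed

text \<open>Isomorphism is symmetric and transitive. The cuspidal support compares whole classes,
  whereas an explicit isomorphism yields only membership in a class.\<close>

lemma iso_class_eq:
  assumes rep: "is_representation (GL (rk \<tau>)) fun_scale (rep_space \<tau>) (act \<tau>)" and \<sigma>: "\<sigma> \<in> iso_class \<tau>"
  shows "iso_class \<sigma> = iso_class \<tau>"
proof -
  obtain f where rk: "rk \<sigma> = rk \<tau>"
    and f: "intertwiner (GL (rk \<tau>)) fun_scale (rep_space \<tau>) (act \<tau>) fun_scale (rep_space \<sigma>) (act \<sigma>) f"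
    "bij_betw f (rep_space \<tau>) (rep_space \<sigma>)"
    using \<sigma> by (auto simp: iso_class_def)
  note fi = intertwiner_inv_into[OF rep f] bij_betw_inv_into[OF f(2)]
  show ?thesis
  proof (intro equalityI subsetI)
    fix \<kappa> assume "\<kappa> \<in> iso_class \<sigma>"
    then show "\<kappa> \<in> iso_class \<tau>"
      using intertwiner_comp[OF f(1)] bij_betw_trans[OF f(2)] rk unfolding iso_class_def by fastforce
  next
    fix \<kappa> assume "\<kappa> \<in> iso_class \<tau>"
    then show "\<kappa> \<in> iso_class \<sigma>"
      using intertwiner_comp[OF fi(1)] bij_betw_trans[OF fi(2)] rk unfolding iso_class_def by fastforce
  qed
qed

lemma vector_space_fun_scale: "vector_space (fun_scale :: 'r::field \<Rightarrow> ('i \<Rightarrow> 'r) \<Rightarrow> 'i \<Rightarrow> 'r)"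
  by unfold_locales (auto simp: fun_scale_def fun_eq_iff algebra_simps)

text \<open>The only singular matrix of size 1 is zero, so the coefficient is the sum of all
  \<open>act \<rho> g v\<close>. It is fixed by the group; if it were nonzero, irreducibility would
  make its line the whole space and \<open>\<rho>\<close> trivial.\<close>

lemma rank_one_vanishes_on_singular:
  fixes \<rho> :: "('k::{field,finite}, 'r::field) glrep"
  assumes irr: "irreducible_rep (GL (rk \<rho>)) fun_scale (rep_space \<rho>) (act \<rho>)" and rk: "rk \<rho> = 1"
    and nontriv: "iso_class \<rho> \<noteq> iso_class trivial_GL1" and \<psi>: "nontrivial_character \<psi>"
    and v: "v \<in> rep_space \<rho>"
  shows "vanishes_on_singular fun_scale 1 \<psi> (\<lambda>g. act \<rho> (inv\<^bsub>GL 1\<^esub> g) v)"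
  unfolding vanishes_on_singular_def
proof (intro ballI impI)
  fix a :: "'k mat" assume a: "a \<in> carrier_mat 1 1" "det a = 0"
  define n :: nat where "n = 1"
  have rep: "is_representation (GL n) fun_scale (rep_space \<rho>) (act \<rho>)"
    using irr rk by (simp add: irreducible_rep_def n_def)
  note R = representationD[OF rep]
  interpret vector_space "fun_scale :: 'r \<Rightarrow> (nat \<Rightarrow> 'r) \<Rightarrow> nat \<Rightarrow> 'r" by (rule R(1))
  have a0: "a = 0\<^sub>m n n" using singular_1[OF a] by (simp add: n_def)
  define w where "w = gl_fourier fun_scale n \<psi> (\<lambda>g. act \<rho> (inv\<^bsub>GL n\<^esub> g) v) a"
  have w_eq: "w = (\<Sum>g\<in>carrier (GL n). act \<rho> g v)"
    unfolding w_def a0 gl_fourier_zero[OF \<psi> R(1)]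
    by (rule sum.reindex_bij_betw[OF bij_betw_GL_inv])
  have wV: "w \<in> rep_space \<rho>"
    unfolding w_eq using R(4) v by (intro subspace_sum[OF R(2)]) auto
  have fixed: "act \<rho> h w = w" if h: "h \<in> carrier (GL n)" for h
  proof -
    have "act \<rho> h w = (\<Sum>g\<in>carrier (GL n). act \<rho> h (act \<rho> g v))"
      unfolding w_eq using linear_on_sum[OF R(1,2) R(3)[OF h], of "carrier (GL n)" "\<lambda>g. act \<rho> g v" "\<lambda>_. 1"]
        R(4)[OF _ v] by (simp add: finite_GL)
    also have "\<dots> = (\<Sum>g\<in>carrier (GL n). act \<rho> (h * g) v)"
      using R(6)[OF h _ v] by (auto intro!: sum.cong)
    also have "\<dots> = w"
      unfolding w_eq by (rule sum.reindex_bij_betw[OF bij_betw_GL_mult_left[OF h]])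
    finally show ?thesis .
  qed
  have "w = 0"
  proof (rule ccontr)
    assume "w \<noteq> 0"
    define W where "W = range (\<lambda>c. fun_scale c w)"
    have fixW: "act \<rho> h (fun_scale c w) = fun_scale c w" if "h \<in> carrier (GL n)" for h c
      using R(3)[OF that] wV fixed[OF that] by (simp add: linear_on_def)
    have "W = {0} \<or> W = rep_space \<rho>"
    proof -
      have "W \<subseteq> rep_space \<rho>" using subspace_scale[OF R(2) wV] by (auto simp: W_def)
      moreover have "subspace W"
      proof (rule subspaceI)
        show "0 \<in> W" unfolding W_def by (metis rangeI scale_zero_left)
        show "x + y \<in> W" if "x \<in> W" "y \<in> W" for x y
          using that unfolding W_def by (auto simp: scale_left_distrib[symmetric])
        show "fun_scale c x \<in> W" if "x \<in> W" for c x
          using that unfolding W_def by auto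
      qed
      moreover have "\<forall>g\<in>carrier (GL n). act \<rho> g ` W \<subseteq> W"
        using fixW by (auto simp: W_def)
      ultimately show ?thesis using irr rk by (simp add: irreducible_rep_def n_def)
    qed
    moreover have "w \<in> W" unfolding W_def by (metis rangeI scale_one)
    ultimately have W: "rep_space \<rho> = W" using \<open>w \<noteq> 0\<close> by auto
    \<comment> \<open>The space of \<open>trivial_GL1\<close> has the single coordinate 0, which
      becomes the multiple of \<open>w\<close>.\<close>
    define f :: "(nat \<Rightarrow> 'r) \<Rightarrow> nat \<Rightarrow> 'r" where "f c = fun_scale (c 0) w" for c
    have "bij_betw f (rep_space (trivial_GL1 :: ('k, 'r) glrep)) (rep_space \<rho>)"
      unfolding W bij_betw_def
    proof
      show "inj_on f (rep_space (trivial_GL1 :: ('k, 'r) glrep))"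
      proof (rule inj_onI)
        fix x y assume xy: "x \<in> rep_space (trivial_GL1 :: ('k, 'r) glrep)"
          "y \<in> rep_space (trivial_GL1 :: ('k, 'r) glrep)" "f x = f y"
        have "x 0 = y 0" using xy(3) \<open>w \<noteq> 0\<close> by (simp add: f_def)
        moreover have "x i = 0" "y i = 0" if "0 < i" for i
          using xy(1,2) that by (auto simp: rep_space_def trivial_GL1_def coords_def)
        ultimately show "x = y" by (metis ext gr0I)
      qed
      have "fun_scale c w \<in> f ` rep_space (trivial_GL1 :: ('k, 'r) glrep)" for c
        by (rule image_eqI[of _ _ "\<lambda>i. if i = 0 then c else 0"])
          (auto simp: f_def rep_space_def trivial_GL1_def coords_def)
      then show "f ` rep_space (trivial_GL1 :: ('k, 'r) glrep) = W"
        by (auto simp: W_def f_def)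
    qed
    moreover have "intertwiner (GL 1) fun_scale (rep_space (trivial_GL1 :: ('k, 'r) glrep))
      (act (trivial_GL1 :: ('k, 'r) glrep)) fun_scale (rep_space \<rho>) (act \<rho>) f"
      unfolding intertwiner_def linear_on_def W
      using fixW by (auto simp: f_def W_def trivial_GL1_def n_def plus_fun_def distrib_right fun_scale_def mult.assoc)
    ultimately have "\<rho> \<in> iso_class trivial_GL1"
      using rep rk by (auto simp: iso_class_def trivial_GL1_def n_def)
    moreover have "is_representation (GL (rk (trivial_GL1 :: ('k, 'r) glrep))) fun_scale
      (rep_space (trivial_GL1 :: ('k, 'r) glrep)) (act (trivial_GL1 :: ('k, 'r) glrep))"
      unfolding is_representation_def
    proof (intro conjI)
      show "subspace (rep_space (trivial_GL1 :: ('k, 'r) glrep))"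
        by (rule subspaceI) (auto simp: rep_space_def coords_def fun_scale_def)
    qed (auto simp: linear_on_def trivial_GL1_def vector_space_fun_scale)
    ultimately show False using iso_class_eq nontriv by blast
  qed
  then show "gl_fourier fun_scale 1 \<psi> (\<lambda>g. act \<rho> (inv\<^bsub>GL 1\<^esub> g) v) a = 0"
    by (simp add: w_def n_def)
qed

section \<open>Parabolic induction\<close>

abbreviation tail_sum :: "nat list \<Rightarrow> nat \<Rightarrow> nat" where
  "tail_sum ms k \<equiv> sum_list (drop k ms)"

lemma offset_tail_sum: "offset ms k + tail_sum ms k = sum_list ms"
  unfolding offset_def by (metis append_take_drop_id sum_list_append)

lemma tail_sum_Suc: "k < length ms \<Longrightarrow> tail_sum ms k = ms ! k + tail_sum ms (Suc k)"
  by (simp add: Cons_nth_drop_Suc[symmetric])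

lemma offset_Suc: "k < length ms \<Longrightarrow> offset ms (Suc k) = offset ms k + ms ! k"
  by (simp add: offset_def take_Suc_conv_app_nth)

lemma offset_mono: "j \<le> k \<Longrightarrow> offset ms j \<le> offset ms k"
proof -
  assume "j \<le> k"
  then obtain d where "k = j + d" using le_Suc_ex by blast
  then show ?thesis by (simp add: offset_def take_add)
qed

lemma offset_le: "offset ms k \<le> sum_list ms"
  using offset_tail_sum[of ms k] by simp

text \<open>The blocks from \<open>k\<close> on fill the lower right corner; varying
  \<open>k\<close> peels off one block at a time.\<close>

definition block_lift :: "nat list \<Rightarrow> nat \<Rightarrow> 'k::field mat \<Rightarrow> 'k mat" where
  "block_lift ms k A = bdiag (1\<^sub>m (offset ms k)) A"

lemma block_lift_GL:
  "A \<in> carrier (GL (tail_sum ms k)) \<Longrightarrow> block_lift ms k A \<in> carrier (GL (sum_list ms))"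
  using bdiag_GL[OF GL_one_closed[of "offset ms k"], of A "tail_sum ms k"]
  by (simp add: block_lift_def offset_tail_sum)

lemma block_lift_mult:
  assumes "A \<in> carrier (GL (tail_sum ms k))" "B \<in> carrier (GL (tail_sum ms k))"
    and y: "y \<in> carrier (GL (sum_list ms))"
  shows "block_lift ms k (A * B) * y = block_lift ms k A * (block_lift ms k B * y)"
proof -
  have "block_lift ms k (A * B) = block_lift ms k A * block_lift ms k B"
    using assms(1,2)
    by (simp add: block_lift_def bdiag_mult[of _ "offset ms k" _ _ "tail_sum ms k"] GL_carrier_mat)
  then show ?thesis
    using GL_carrier_mat[OF block_lift_GL[OF assms(1)]] GL_carrier_mat[OF block_lift_GL[OF assms(2)]]
      GL_carrier_mat[OF y] by (simp add: assoc_mult_mat)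
qed

lemma block_lift_Suc:
  assumes "k < length ms" "A \<in> carrier_mat (tail_sum ms (Suc k)) (tail_sum ms (Suc k))"
  shows "block_lift ms k (bdiag (1\<^sub>m (ms ! k)) A) = block_lift ms (Suc k) A"
  unfolding block_lift_def bdiag_def using assms
  by (intro eq_matI) (auto simp: offset_Suc)

text \<open>Such a matrix agrees with the identity outside the rows of block \<open>k\<close>. With
  \<open>h = 1\<close> it supplies the unipotent elements, and with \<open>X = 0\<close> the Levi
  elements, to which the equivariance of induced functions is applied.\<close>

lemma block_lift_parabolic:
  assumes k: "k < length ms" and h: "h \<in> carrier (GL (ms ! k))"
    and X: "X \<in> carrier_mat (ms ! k) (tail_sum ms (Suc k))"
    and A: "A = four_block_mat h X (0\<^sub>m (tail_sum ms (Suc k)) (ms ! k)) (1\<^sub>m (tail_sum ms (Suc k)))"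
  shows "block_lift ms k A \<in> std_parabolic ms"
    and "\<And>j. j < length ms \<Longrightarrow> diag_block ms j (block_lift ms k A) = (if j = k then h else 1\<^sub>m (ms ! j))"
proof -
  let ?o = "offset ms k" and ?m = "ms ! k" and ?T = "tail_sum ms (Suc k)"
  let ?p = "block_lift ms k A"
  have n: "sum_list ms = ?o + ?m + ?T"
    using offset_tail_sum[of ms k] tail_sum_Suc[OF k] by simp
  have hc: "h \<in> carrier_mat ?m ?m" by (rule GL_carrier_mat[OF h])
  have A_GL: "A \<in> carrier (GL (?m + ?T))"
    unfolding A using h X hc by (simp add: carrier_GL det_four_block_mat_lower_left_zero[of _ ?m _ ?T])
  \<comment> \<open>For a row of block \<open>k\<close> the columns split into those before the
    block, inside it and to its right.\<close>
  have p_entry: "?p $$ (a, b) =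
      (if a < ?o \<or> ?o + ?m \<le> a then (if a = b then 1 else 0)
       else if b < ?o then 0
       else if b < ?o + ?m then h $$ (a - ?o, b - ?o) else X $$ (a - ?o, b - ?o - ?m))"
    if "a < sum_list ms" "b < sum_list ms" for a b
    using that hc X unfolding block_lift_def bdiag_def A n by (auto simp: less_diff_conv2)
  have p_GL: "?p \<in> carrier (GL (sum_list ms))"
    using A_GL by (intro block_lift_GL) (simp add: tail_sum_Suc[OF k])
  have before: "offset ms j + ms ! j \<le> ?o" if "j < k" for j
    using offset_mono[of "Suc j" k ms] offset_Suc[of j ms] that k by simp
  have after: "?o + ?m \<le> offset ms j" if "k < j" for j
    using offset_mono[of "Suc k" j ms] offset_Suc[OF k] that by simp
  show "?p \<in> std_parabolic ms"
    unfolding std_parabolic_def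
  proof (intro CollectI conjI allI impI p_GL)
    fix j a b
    assume j: "j < length ms" and ab: "offset ms j \<le> a \<and> a < sum_list ms \<and> b < offset ms j"
    have b: "b < sum_list ms" using ab offset_le[of ms j] by simp
    show "?p $$ (a, b) = 0"
    proof (cases "a < ?o \<or> ?o + ?m \<le> a")
      case True
      then show ?thesis using p_entry[of a b] ab b by auto
    next
      case False
      \<comment> \<open>A row of block \<open>k\<close> is only required to vanish to the left of
        that block, where \<open>p_entry\<close> gives 0.\<close>
      then have "\<not> k < j" using after[of j] ab by auto
      then have "offset ms j \<le> ?o" by (intro offset_mono) simp
      then show ?thesis using p_entry[of a b] ab b False by auto
    qed
  qed
  show "diag_block ms j ?p = (if j = k then h else 1\<^sub>m (ms ! j))" if j: "j < length ms" for j
  proof (rule eq_matI)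
    fix a b
    assume "a < dim_row (if j = k then h else 1\<^sub>m (ms ! j))" "b < dim_col (if j = k then h else 1\<^sub>m (ms ! j))"
    then have ab: "a < ms ! j" "b < ms ! j" using hc by (auto split: if_splits)
    have lt: "offset ms j + a < sum_list ms" "offset ms j + b < sum_list ms"
      using ab offset_Suc[OF j] offset_le[of ms "Suc j"] by auto
    have "diag_block ms j ?p $$ (a, b) = ?p $$ (offset ms j + a, offset ms j + b)"
      using ab by (simp add: diag_block_def)
    also have "\<dots> = (if j = k then h else 1\<^sub>m (ms ! j)) $$ (a, b)"
    proof (cases "j = k")
      case True
      then show ?thesis using p_entry[OF lt] ab by auto
    next
      case False
      then have "offset ms j + a < ?o \<or> ?o + ?m \<le> offset ms j + a"
        using before[of j] after[of j] ab by (cases "j < k") auto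
      then show ?thesis using p_entry[OF lt] ab False by auto
    qed
    finally show "diag_block ms j ?p $$ (a, b) = (if j = k then h else 1\<^sub>m (ms ! j)) $$ (a, b)" .
  qed (use hc in \<open>auto simp: diag_block_def\<close>)
qed

section \<open>Tensor products in coordinates\<close>

lemma finite_multi_indices: "finite (multi_indices ds)"
proof (rule finite_subset)
  show "multi_indices ds \<subseteq> {is. set is \<subseteq> {..<Suc (Max (set ds \<union> {0}))} \<and> length is = length ds}"
  proof (intro subsetI CollectI conjI)
    fix "is" i assume is_mem: "is \<in> multi_indices ds" and "i \<in> set is"
    then obtain k where k: "k < length ds" "i = is ! k"
      by (auto simp: multi_indices_def in_set_conv_nth)
    then have "i < ds ! k" using is_mem by (auto simp: multi_indices_def)
    also have "ds ! k \<le> Max (set ds \<union> {0})" using k by (intro Max_ge) auto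
    finally show "i \<in> {..<Suc (Max (set ds \<union> {0}))}" by simp
  qed (auto simp: multi_indices_def)
qed (rule finite_lists_length_eq, simp)

definition unit_vec_fun :: "nat \<Rightarrow> nat \<Rightarrow> 'r::field" where
  "unit_vec_fun j = (\<lambda>i. if i = j then 1 else 0)"

lemma unit_vec_fun_rep_space: "j < dm \<rho> \<Longrightarrow> unit_vec_fun j \<in> rep_space \<rho>"
  by (auto simp: unit_vec_fun_def rep_space_def coords_def)

lemma entry_eq: "entry A i j = A (unit_vec_fun j) i"
  by (simp add: entry_def unit_vec_fun_def)

lemma sum_fun_scale_apply: "(\<Sum>x\<in>A. fun_scale (c x) (f x)) i = (\<Sum>x\<in>A. c x * f x i)"
  by (induction A rule: infinite_finite_induct) (auto simp: fun_scale_def)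

locale induction_data =
  fixes \<rho>s :: "('k::{field,finite}, 'r::field) glrep list"
  assumes reps: "\<And>\<rho>. \<rho> \<in> set \<rho>s \<Longrightarrow> is_representation (GL (rk \<rho>)) fun_scale (rep_space \<rho>) (act \<rho>)"
begin

abbreviation ranks :: "nat list" where "ranks \<equiv> map rk \<rho>s"
abbreviation dims :: "nat list" where "dims \<equiv> map dm \<rho>s"
abbreviation total :: nat where "total \<equiv> sum_list ranks"

text \<open>The bound on \<open>j\<close> matters: only vectors inside \<open>rep_space\<close> are
  known to be fixed by the identity matrix.\<close>

lemma entry_one:
  assumes "l < length \<rho>s" "j < dims ! l"
  shows "entry (act (\<rho>s ! l) (1\<^sub>m (ranks ! l))) i j = (if i = j then 1 else 0)"
  using representationD(5)[OF reps[of "\<rho>s ! l"] unit_vec_fun_rep_space[of j "\<rho>s ! l"]] assms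
  by (simp add: entry_eq) (simp add: unit_vec_fun_def)

text \<open>All Kronecker factors except the \<open>k\<close>-th are identity matrices and become
  Kronecker deltas. The entry that depends on \<open>h\<close> is singled out, so that a sum over
  \<open>h\<close> can later act on it alone.\<close>

lemma inflated_act_lift:
  assumes k: "k < length \<rho>s" and is_mem: "is \<in> multi_indices dims"
    and p: "\<And>j. j < length ranks \<Longrightarrow> diag_block ranks j p = (if j = k then h else 1\<^sub>m (ranks ! j))"
  shows "inflated_act \<rho>s p T is = (\<Sum>js\<in>multi_indices dims.
    entry (act (\<rho>s ! k) h) (is ! k) (js ! k) *
      ((\<Prod>l\<in>{..<length \<rho>s} - {k}. if is ! l = js ! l then 1 else 0) * T js))"
  unfolding inflated_act_def tensor_op_def using is_mem
proof (simp, intro sum.cong refl)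
  fix js assume js: "js \<in> multi_indices dims"
  have "(\<Prod>l<length \<rho>s. entry (act (\<rho>s ! l) (diag_block ranks l p)) (is ! l) (js ! l)) =
    entry (act (\<rho>s ! k) h) (is ! k) (js ! k) *
    (\<Prod>l\<in>{..<length \<rho>s} - {k}. entry (act (\<rho>s ! l) (diag_block ranks l p)) (is ! l) (js ! l))"
    using k p[of k] by (subst prod.remove[of _ k]) auto
  also have "(\<Prod>l\<in>{..<length \<rho>s} - {k}. entry (act (\<rho>s ! l) (diag_block ranks l p)) (is ! l) (js ! l)) =
    (\<Prod>l\<in>{..<length \<rho>s} - {k}. if is ! l = js ! l then 1 else 0)"
    using js p entry_one by (intro prod.cong) (auto simp: multi_indices_def)
  finally show "(\<Prod>l<length \<rho>s. entry (act (\<rho>s ! l) (diag_block ranks l p)) (is ! l) (js ! l)) * T js =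
    entry (act (\<rho>s ! k) h) (is ! k) (js ! k) *
      ((\<Prod>l\<in>{..<length \<rho>s} - {k}. if is ! l = js ! l then 1 else 0) * T js)"
    by (simp add: mult.assoc)
qed

text \<open>The case \<open>h = 1\<close> of \<open>inflated_act_lift\<close>, where all deltas
  together force \<open>is = js\<close>. The case distinction for \<open>p\<close> has the form
  delivered by \<open>block_lift_parabolic\<close>.\<close>

lemma inflated_act_unipotent:
  assumes k: "k < length \<rho>s" and is_mem: "is \<in> multi_indices dims"
    and p: "\<And>j. j < length ranks \<Longrightarrow> diag_block ranks j p = (if j = k then 1\<^sub>m (ranks ! k) else 1\<^sub>m (ranks ! j))"
  shows "inflated_act \<rho>s p T is = T is"
proof -
  have "inflated_act \<rho>s p T is = (\<Sum>js\<in>multi_indices dims.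
    entry (act (\<rho>s ! k) (1\<^sub>m (ranks ! k))) (is ! k) (js ! k) *
      ((\<Prod>l\<in>{..<length \<rho>s} - {k}. if is ! l = js ! l then 1 else 0) * T js))"
    using k is_mem p by (rule inflated_act_lift)
  also have "\<dots> = (\<Sum>js\<in>multi_indices dims. if is = js then T js else 0)"
  proof (rule sum.cong[OF refl])
    fix js assume js: "js \<in> multi_indices dims"
    have e: "entry (act (\<rho>s ! k) (1\<^sub>m (ranks ! k))) (is ! k) (js ! k) = (if is ! k = js ! k then 1 else 0)"
      using entry_one[of k "js ! k"] k js by (auto simp: multi_indices_def)
    show "entry (act (\<rho>s ! k) (1\<^sub>m (ranks ! k))) (is ! k) (js ! k) *
      ((\<Prod>l\<in>{..<length \<rho>s} - {k}. if is ! l = js ! l then 1 else 0) * T js) = (if is = js then T js else 0)"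
    proof (cases "is = js")
      case False
      \<comment> \<open>The indices differ at some place \<open>l\<close>: for \<open>l = k\<close>
        the singled-out entry vanishes, otherwise one of the deltas does.\<close>
      then obtain l where l: "l < length \<rho>s" "is ! l \<noteq> js ! l"
        using js is_mem by (auto simp: multi_indices_def list_eq_iff_nth_eq)
      show ?thesis
      proof (cases "l = k")
        case True
        with l False show ?thesis unfolding e by simp
      next
        case l_k: False
        have "(\<Prod>l\<in>{..<length \<rho>s} - {k}. if is ! l = js ! l then 1 else (0::'r)) = 0"
          using l l_k by (intro prod_zero) auto
        with False show ?thesis by simp
      qed
    qed (use e in simp)
  qed
  also have "\<dots> = T is" using is_mem by (simp add: finite_multi_indices)
  finally show ?thesis .
qed

lemma induced_spaceD:
  assumes "\<phi> \<in> induced_space \<rho>s" "p \<in> std_parabolic ranks" "x \<in> carrier (GL total)"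
  shows "\<phi> (p * x) = inflated_act \<rho>s p (\<phi> x)"
  using assms by (simp add: induced_space_def)

text \<open>Descending induction on \<open>k\<close>, with
  \<open>vanishes_on_singular_two_blocks\<close> splitting block \<open>k\<close> from the later
  ones. The inverse in the argument of \<open>\<phi>\<close> turns right multiplication of
  \<open>g\<close> into left multiplication by parabolic elements, where equivariance applies. The
  point \<open>y\<close> is arbitrary because the induction absorbs \<open>g\<close> into
  it.\<close>

lemma induced_vanishes_on_singular:
  assumes \<psi>: "nontrivial_character \<psi>" and \<phi>: "\<phi> \<in> induced_space \<rho>s"
    and van: "\<And>\<rho> v. \<rho> \<in> set \<rho>s \<Longrightarrow> v \<in> rep_space \<rho> \<Longrightarrow>
      vanishes_on_singular fun_scale (rk \<rho>) \<psi> (\<lambda>g. act \<rho> (inv\<^bsub>GL (rk \<rho>)\<^esub> g) v)"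
    and is_mem: "is \<in> multi_indices dims"
    and "k \<le> length \<rho>s" and "y \<in> carrier (GL total)"
  shows "vanishes_on_singular (*) (tail_sum ranks k) \<psi>
    (\<lambda>g. \<phi> (block_lift ranks k (inv\<^bsub>GL (tail_sum ranks k)\<^esub> g) * y) is)"
  using assms(5,6)
proof (induction k arbitrary: y rule: inc_induct)
  case base
  \<comment> \<open>No block is left: the rank is 0 and no matrix is singular.\<close>
  then show ?case by (simp add: vanishes_on_singular_def)
next
  case (step k)
  have k: "k < length \<rho>s" "k < length ranks" using step by auto
  note y = \<open>y \<in> carrier (GL total)\<close>
  let ?m = "ranks ! k" and ?T = "tail_sum ranks (Suc k)"
  let ?i = "\<lambda>g. inv\<^bsub>GL (?m + ?T)\<^esub> g"
  have T: "tail_sum ranks k = ?m + ?T" by (rule tail_sum_Suc[OF k(2)])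
  have lift_mult: "block_lift ranks k (A * B) * y = block_lift ranks k A * (block_lift ranks k B * y)"
    if "A \<in> carrier (GL (?m + ?T))" "B \<in> carrier (GL (?m + ?T))" for A B
    using block_lift_mult[where ms = ranks and k = k and A = A and B = B] that y by (simp only: T)
  have lift: "block_lift ranks k A * y \<in> carrier (GL total)" if "A \<in> carrier (GL (?m + ?T))" for A
    using block_lift_GL[where ms = ranks and k = k and A = A] that y by (auto simp only: T intro: GL_mult_closed)
  have "vanishes_on_singular (*) (?m + ?T) \<psi> (\<lambda>g. \<phi> (block_lift ranks k (?i g) * y) is)"
  proof (rule vanishes_on_singular_two_blocks[OF _ \<psi>])
    show "vector_space ((*) :: 'r \<Rightarrow> 'r \<Rightarrow> 'r)" by unfold_locales (auto simp: algebra_simps)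
    fix g :: "'k mat" assume g: "g \<in> carrier (GL (?m + ?T))"
    \<comment> \<open>Collects everything to the right of the new factor, since
      \<open>inv (g * A)\<close> is \<open>inv A\<close> times \<open>inv g\<close>.\<close>
    define z where "z = block_lift ranks k (?i g) * y"
    have z: "z \<in> carrier (GL total)" unfolding z_def by (rule lift[OF GL_inv_closed[OF g]])
    have split: "block_lift ranks k (?i (g * A)) * y = block_lift ranks k (?i A) * z"
      if "A \<in> carrier (GL (?m + ?T))" for A
      using lift_mult[OF GL_inv_closed[OF that] GL_inv_closed[OF g]] GL_inv_mult[OF g that]
      by (simp add: z_def)
    show "\<phi> (block_lift ranks k (?i (g * unip ?m ?T X)) * y) is = \<phi> (block_lift ranks k (?i g) * y) is"
      if X: "X \<in> carrier_mat ?m ?T" for X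
    proof -
      have uX: "- X \<in> carrier_mat ?m ?T" using X by simp
      note P = block_lift_parabolic[OF k(2) GL_one_closed uX unip_def]
      have "\<phi> (block_lift ranks k (?i (g * unip ?m ?T X)) * y) is =
        \<phi> (block_lift ranks k (unip ?m ?T (- X)) * z) is"
        using split[OF unip_GL[OF X]] by (simp only: unip_inv[OF X])
      also have "\<dots> = \<phi> z is"
        unfolding induced_spaceD[OF \<phi> P(1) z] by (rule inflated_act_unipotent[OF k(1) is_mem], rule P(2))
      finally show ?thesis by (simp only: z_def)
    qed
    show "vanishes_on_singular (*) ?m \<psi>
      (\<lambda>h. \<phi> (block_lift ranks k (?i (g * bdiag h (1\<^sub>m ?T))) * y) is)"
      unfolding vanishes_on_singular_def
    proof (intro ballI impI)
      fix b :: "'k mat" assume b: "b \<in> carrier_mat ?m ?m" "det b = 0"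
      \<comment> \<open>The part of the summand that does not depend on \<open>h\<close>.\<close>
      let ?W = "\<lambda>js. (\<Prod>l\<in>{..<length \<rho>s} - {k}. if is ! l = js ! l then 1 else 0) * \<phi> z js"
      have act: "\<phi> (block_lift ranks k (?i (g * bdiag h (1\<^sub>m ?T))) * y) is =
        (\<Sum>js\<in>multi_indices dims. entry (act (\<rho>s ! k) (inv\<^bsub>GL ?m\<^esub> h)) (is ! k) (js ! k) * ?W js)"
        if h: "h \<in> carrier (GL ?m)" for h
      proof -
        have ih: "inv\<^bsub>GL ?m\<^esub> h \<in> carrier (GL ?m)" by (rule GL_inv_closed[OF h])
        have A: "bdiag (inv\<^bsub>GL ?m\<^esub> h) (1\<^sub>m ?T) =
          four_block_mat (inv\<^bsub>GL ?m\<^esub> h) (0\<^sub>m ?m ?T) (0\<^sub>m ?T ?m) (1\<^sub>m ?T)"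
          using GL_carrier_mat[OF ih] by (simp add: bdiag_def)
        note P = block_lift_parabolic[OF k(2) ih zero_carrier_mat A]
        have "\<phi> (block_lift ranks k (?i (g * bdiag h (1\<^sub>m ?T))) * y) is =
          \<phi> (block_lift ranks k (bdiag (inv\<^bsub>GL ?m\<^esub> h) (1\<^sub>m ?T)) * z) is"
          using split[OF bdiag_GL[OF h GL_one_closed]]
          by (simp only: bdiag_inv[OF h GL_one_closed] GL_inv_one)
        also have "\<dots> = inflated_act \<rho>s (block_lift ranks k (bdiag (inv\<^bsub>GL ?m\<^esub> h) (1\<^sub>m ?T))) (\<phi> z) is"
          unfolding induced_spaceD[OF \<phi> P(1) z] ..
        also have "\<dots> = (\<Sum>js\<in>multi_indices dims.
            entry (act (\<rho>s ! k) (inv\<^bsub>GL ?m\<^esub> h)) (is ! k) (js ! k) * ?W js)"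
          by (rule inflated_act_lift[OF k(1) is_mem], rule P(2))
        finally show ?thesis .
      qed
      \<comment> \<open>Each such sum is a coordinate of a singular coefficient of the
        \<open>k\<close>-th factor at a standard basis vector.\<close>
      have zero: "(\<Sum>h\<in>carrier (GL ?m). \<psi> (mtrace (b * h)) *
          entry (act (\<rho>s ! k) (inv\<^bsub>GL ?m\<^esub> h)) (is ! k) (js ! k)) = 0"
        if js: "js \<in> multi_indices dims" for js
      proof -
        have lt: "js ! k < dm (\<rho>s ! k)" using js k by (auto simp: multi_indices_def)
        have "vanishes_on_singular fun_scale ?m \<psi>
            (\<lambda>g. act (\<rho>s ! k) (inv\<^bsub>GL ?m\<^esub> g) (unit_vec_fun (js ! k)))"
          using van[OF nth_mem[OF k(1)] unit_vec_fun_rep_space[OF lt]] k(1) by simp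
        from fun_cong[OF vanishes_on_singularD[OF this b], of "is ! k"]
        show ?thesis by (simp add: gl_fourier_def sum_fun_scale_apply entry_eq)
      qed
      have "gl_fourier (*) ?m \<psi> (\<lambda>h. \<phi> (block_lift ranks k (?i (g * bdiag h (1\<^sub>m ?T))) * y) is) b =
        (\<Sum>h\<in>carrier (GL ?m). \<Sum>js\<in>multi_indices dims.
          \<psi> (mtrace (b * h)) * entry (act (\<rho>s ! k) (inv\<^bsub>GL ?m\<^esub> h)) (is ! k) (js ! k) * ?W js)"
        unfolding gl_fourier_def
        by (intro sum.cong refl) (simp only: act sum_distrib_left mult.assoc)
      also have "\<dots> = (\<Sum>js\<in>multi_indices dims. (\<Sum>h\<in>carrier (GL ?m).
          \<psi> (mtrace (b * h)) * entry (act (\<rho>s ! k) (inv\<^bsub>GL ?m\<^esub> h)) (is ! k) (js ! k)) * ?W js)"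
        by (subst sum.swap) (simp only: sum_distrib_right)
      also have "\<dots> = 0"
        by (rule sum.neutral, rule ballI) (simp only: zero mult_zero_left)
      finally show "gl_fourier (*) ?m \<psi>
        (\<lambda>h. \<phi> (block_lift ranks k (?i (g * bdiag h (1\<^sub>m ?T))) * y) is) b = 0" .
    qed
    \<comment> \<open>The lower Levi factor is the trailing embedding for \<open>Suc k\<close>, so
      the induction hypothesis applies with \<open>z\<close> in place of \<open>y\<close>.\<close>
    have R: "\<phi> (block_lift ranks k (?i (g * bdiag (1\<^sub>m ?m) h)) * y) is =
      \<phi> (block_lift ranks (Suc k) (inv\<^bsub>GL ?T\<^esub> h) * z) is" if h: "h \<in> carrier (GL ?T)" for h
      using split[OF bdiag_GL[OF GL_one_closed h]]
      by (simp only: bdiag_inv[OF GL_one_closed h] GL_inv_one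
          block_lift_Suc[OF k(2) GL_carrier_mat[OF GL_inv_closed[OF h]]])
    have "vanishes_on_singular (*) ?T \<psi>
        (\<lambda>h. \<phi> (block_lift ranks k (?i (g * bdiag (1\<^sub>m ?m) h)) * y) is) =
      vanishes_on_singular (*) ?T \<psi>
        (\<lambda>h. \<phi> (block_lift ranks (Suc k) (inv\<^bsub>GL ?T\<^esub> h) * z) is)"
      by (rule vanishes_on_singular_cong) (rule R)
    with step.IH[OF z] show "vanishes_on_singular (*) ?T \<psi>
      (\<lambda>h. \<phi> (block_lift ranks k (?i (g * bdiag (1\<^sub>m ?m) h)) * y) is)"
      by (simp only:)
  qed
  then show ?case by (simp only: T)
qed

section \<open>The induced representation and its quotients\<close>

lemma vector_space_induced_scale:
  "vector_space (induced_scale :: 'r \<Rightarrow> ('k mat \<Rightarrow> nat list \<Rightarrow> 'r) \<Rightarrow> 'k mat \<Rightarrow> nat list \<Rightarrow> 'r)"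
  by unfold_locales (auto simp: induced_scale_def fun_scale_def fun_eq_iff algebra_simps)

lemma inflated_act_linear:
  "inflated_act \<rho>s p (T + T') = inflated_act \<rho>s p T + inflated_act \<rho>s p T'"
  "inflated_act \<rho>s p (fun_scale c T) = fun_scale c (inflated_act \<rho>s p T)"
  by (auto simp: inflated_act_def tensor_op_def fun_eq_iff fun_scale_def distrib_left sum.distrib
      sum_distrib_left mult.left_commute)

lemma subspace_induced_space: "module.subspace induced_scale (induced_space \<rho>s)"
proof -
  interpret vector_space "induced_scale :: 'r \<Rightarrow> ('k mat \<Rightarrow> nat list \<Rightarrow> 'r) \<Rightarrow> 'k mat \<Rightarrow> nat list \<Rightarrow> 'r"
    by (rule vector_space_induced_scale)
  have zero: "inflated_act \<rho>s p 0 = 0" for p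
    by (auto simp: inflated_act_def tensor_op_def fun_eq_iff)
  show ?thesis
  proof (rule subspaceI)
    show "0 \<in> induced_space \<rho>s" by (simp add: induced_space_def coords_def zero)
    show "f + g \<in> induced_space \<rho>s" if "f \<in> induced_space \<rho>s" "g \<in> induced_space \<rho>s" for f g
      using that by (simp add: induced_space_def coords_def inflated_act_linear)
    show "induced_scale c f \<in> induced_space \<rho>s" if "f \<in> induced_space \<rho>s" for c f
      using that by (simp add: induced_space_def coords_def induced_scale_def inflated_act_linear)
        (simp add: fun_scale_def fun_eq_iff)
  qed
qed

lemma induced_act_closed:
  assumes g: "g \<in> carrier (GL total)" and f: "f \<in> induced_space \<rho>s"
  shows "induced_act \<rho>s g f \<in> induced_space \<rho>s"
  unfolding induced_space_def
proof (intro CollectI conjI allI impI ballI)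
  show "induced_act \<rho>s g f x = 0" if "x \<notin> carrier (GL total)" for x
    using that by (simp add: induced_act_def)
  show "induced_act \<rho>s g f x \<in> coords (multi_indices dims)" for x
    using f by (simp add: induced_act_def induced_space_def) (simp add: coords_def)
  show "induced_act \<rho>s g f (p * x) = inflated_act \<rho>s p (induced_act \<rho>s g f x)"
    if p: "p \<in> std_parabolic ranks" and x: "x \<in> carrier (GL total)" for p x
  proof -
    have p': "p \<in> carrier (GL total)" using p by (simp add: std_parabolic_def)
    have "p * x * g = p * (x * g)"
      using GL_carrier_mat[OF p'] GL_carrier_mat[OF x] GL_carrier_mat[OF g] by (rule assoc_mult_mat)
    then show ?thesis
      using induced_spaceD[OF f p GL_mult_closed[OF x g]] GL_mult_closed[OF p' x] x
      by (simp add: induced_act_def)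
  qed
qed

text \<open>Evaluated at a point \<open>y\<close> and a coordinate, the coefficient becomes a scalar
  one. The translation by \<open>y\<close> then amounts to replacing \<open>a\<close> by the
  singular matrix \<open>y * a\<close>, and \<open>induced_vanishes_on_singular\<close> applies with
  \<open>k = 0\<close>, that is, with all blocks.\<close>

lemma gl_fourier_induced_act:
  assumes \<psi>: "nontrivial_character \<psi>" and \<phi>: "\<phi> \<in> induced_space \<rho>s"
    and van: "\<And>\<rho> v. \<rho> \<in> set \<rho>s \<Longrightarrow> v \<in> rep_space \<rho> \<Longrightarrow>
      vanishes_on_singular fun_scale (rk \<rho>) \<psi> (\<lambda>g. act \<rho> (inv\<^bsub>GL (rk \<rho>)\<^esub> g) v)"
    and a: "a \<in> carrier_mat total total" "det a = 0"
  shows "gl_fourier induced_scale total \<psi> (\<lambda>g. induced_act \<rho>s (inv\<^bsub>GL total\<^esub> g) \<phi>) a = 0"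
proof (intro ext)
  fix y :: "'k mat" and "is" :: "nat list"
  have apply_sum: "(\<Sum>g\<in>A. induced_scale (c g) (f g)) y is = (\<Sum>g\<in>A. c g * f g y is)"
    for A :: "'k mat set" and c and f :: "'k mat \<Rightarrow> 'k mat \<Rightarrow> nat list \<Rightarrow> 'r"
    by (induction A rule: infinite_finite_induct) (auto simp: induced_scale_def fun_scale_def)
  have eq: "gl_fourier induced_scale total \<psi> (\<lambda>g. induced_act \<rho>s (inv\<^bsub>GL total\<^esub> g) \<phi>) a y is =
    gl_fourier (*) total \<psi> (\<lambda>g. induced_act \<rho>s (inv\<^bsub>GL total\<^esub> g) \<phi> y is) a"
    by (simp add: gl_fourier_def apply_sum)
  have "gl_fourier (*) total \<psi> (\<lambda>g. induced_act \<rho>s (inv\<^bsub>GL total\<^esub> g) \<phi> y is) a = 0"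
  proof (cases "y \<in> carrier (GL total) \<and> is \<in> multi_indices dims")
    case False
    \<comment> \<open>Outside the group or the index set, all functions of the induced space are
      zero.\<close>
    then have "induced_act \<rho>s g \<phi> y is = 0" for g
      using \<phi> by (auto simp: induced_act_def induced_space_def coords_def)
    then show ?thesis by (simp add: gl_fourier_def)
  next
    case True
    then have y: "y \<in> carrier (GL total)" and is_mem: "is \<in> multi_indices dims" by auto
    have lift0: "block_lift ranks 0 A * 1\<^sub>m total = A" if "A \<in> carrier (GL total)" for A
      using that by (auto simp: block_lift_def bdiag_def offset_def intro!: eq_matI dest!: GL_carrier_mat)
    have "vanishes_on_singular (*) (tail_sum ranks 0) \<psi>
      (\<lambda>g. \<phi> (block_lift ranks 0 (inv\<^bsub>GL (tail_sum ranks 0)\<^esub> g) * 1\<^sub>m total) is)"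
      using \<psi> \<phi> van is_mem _ GL_one_closed by (rule induced_vanishes_on_singular) simp_all
    then have "vanishes_on_singular (*) total \<psi>
      (\<lambda>g. \<phi> (block_lift ranks 0 (inv\<^bsub>GL total\<^esub> g) * 1\<^sub>m total) is)"
      by (simp only: drop_0)
    also have "?this = vanishes_on_singular (*) total \<psi> (\<lambda>g. \<phi> (inv\<^bsub>GL total\<^esub> g) is)"
      by (rule vanishes_on_singular_cong) (simp only: lift0 GL_inv_closed)
    finally have v: "vanishes_on_singular (*) total \<psi> (\<lambda>g. \<phi> (inv\<^bsub>GL total\<^esub> g) is)" .
    \<comment> \<open>\<open>y * inv g\<close> is the inverse of \<open>g * inv y\<close>, a right
      translate of the group variable.\<close>
    have "gl_fourier (*) total \<psi> (\<lambda>g. induced_act \<rho>s (inv\<^bsub>GL total\<^esub> g) \<phi> y is) a =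
      gl_fourier (*) total \<psi> (\<lambda>g. \<phi> (inv\<^bsub>GL total\<^esub> (g * inv\<^bsub>GL total\<^esub> y)) is) a"
      unfolding gl_fourier_def using y
      by (intro sum.cong refl) (simp add: induced_act_def GL_inv_mult GL_inv_closed GL_inv_inv)
    also have "\<dots> = gl_fourier (*) total \<psi> (\<lambda>g. \<phi> (inv\<^bsub>GL total\<^esub> g) is) (y * a)"
      using gl_fourier_translate_right[OF GL_inv_closed[OF y] a(1)] by (simp add: GL_inv_inv[OF y])
    also have "\<dots> = 0"
      using GL_carrier_mat[OF y] a by (intro vanishes_on_singularD[OF v]) (auto simp: det_mult)
    finally show ?thesis .
  qed
  then show "gl_fourier induced_scale total \<psi> (\<lambda>g. induced_act \<rho>s (inv\<^bsub>GL total\<^esub> g) \<phi>) a y is = 0 y is"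
    by (simp add: eq)
qed

end

text \<open>Each member of the support has vanishing singular coefficients: in rank 1 since it is
  not trivial, in higher rank by cuspidality. The induced representation inherits this, and the
  quotient map \<open>F\<close> carries it to \<open>\<pi>\<close>.\<close>

lemma cuspidal_support_vanishes_on_singular:
  fixes s :: "'r::field \<Rightarrow> 'v::ab_group_add \<Rightarrow> 'v" and \<pi> :: "'k::{field,finite} mat \<Rightarrow> 'v \<Rightarrow> 'v"
  assumes supp: "is_cuspidal_support n s UNIV \<pi> M" and triv: "iso_class trivial_GL1 \<notin># M"
    and \<psi>: "nontrivial_character \<psi>"
  shows "vanishes_on_singular s n \<psi> (\<lambda>g. \<pi> (inv\<^bsub>GL n\<^esub> g) v)"
proof -
  obtain \<rho>s F where M: "M = mset (map iso_class \<rho>s)" and comp: "composition n (map rk \<rho>s)"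
    and irr: "\<And>\<rho>. \<rho> \<in> set \<rho>s \<Longrightarrow> irreducible_rep (GL (rk \<rho>)) fun_scale (rep_space \<rho>) (act \<rho>)"
    and cusp: "\<And>\<rho>. \<rho> \<in> set \<rho>s \<Longrightarrow> cuspidal (rk \<rho>) fun_scale (rep_space \<rho>) (act \<rho>)"
    and F: "intertwiner (GL n) induced_scale (induced_space \<rho>s) (induced_act \<rho>s) s UNIV \<pi> F"
    and surj: "F ` induced_space \<rho>s = UNIV"
    using supp unfolding is_cuspidal_support_def by blast
  interpret induction_data \<rho>s
    by unfold_locales (use irr in \<open>auto simp: irreducible_rep_def\<close>)
  have n: "n = total" using comp by (simp add: composition_def)
  have van: "vanishes_on_singular fun_scale (rk \<rho>) \<psi> (\<lambda>g. act \<rho> (inv\<^bsub>GL (rk \<rho>)\<^esub> g) w)"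
    if \<rho>: "\<rho> \<in> set \<rho>s" and w: "w \<in> rep_space \<rho>" for \<rho> w
  proof (cases "rk \<rho> = 1")
    case True
    have "iso_class \<rho> \<noteq> iso_class trivial_GL1"
      using triv \<rho> by (auto simp: M)
    from rank_one_vanishes_on_singular[OF irr[OF \<rho>] True this \<psi> w] show ?thesis
      by (simp only: True)
  next
    case False
    have "0 < rk \<rho>" using comp \<rho> by (simp add: composition_def)
    with False have "2 \<le> rk \<rho>" by simp
    then show ?thesis
      using cuspidal_vanishes_on_singular[OF reps[OF \<rho>] cusp[OF \<rho>] _ w] by blast
  qed
  obtain \<phi> where \<phi>: "\<phi> \<in> induced_space \<rho>s" "v = F \<phi>" using surj by blast
  have lin: "linear_on induced_scale (induced_space \<rho>s) s UNIV F"
    and eqv: "\<And>g f. g \<in> carrier (GL n) \<Longrightarrow> f \<in> induced_space \<rho>s \<Longrightarrow> F (induced_act \<rho>s g f) = \<pi> g (F f)"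
    using F by (auto simp: intertwiner_def)
  show ?thesis
    unfolding vanishes_on_singular_def
  proof (intro ballI impI)
    fix a :: "'k mat" assume a: "a \<in> carrier_mat n n" "det a = 0"
    have "gl_fourier s n \<psi> (\<lambda>g. \<pi> (inv\<^bsub>GL n\<^esub> g) v) a =
      gl_fourier s n \<psi> (\<lambda>g. F (induced_act \<rho>s (inv\<^bsub>GL n\<^esub> g) \<phi>)) a"
      unfolding gl_fourier_def \<phi>(2) by (intro sum.cong refl) (simp add: eqv[OF GL_inv_closed \<phi>(1)])
    also have "\<dots> = F (gl_fourier induced_scale n \<psi> (\<lambda>g. induced_act \<rho>s (inv\<^bsub>GL n\<^esub> g) \<phi>) a)"
      using vector_space_induced_scale subspace_induced_space lin
      by (rule linear_on_gl_fourier[symmetric])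
        (auto simp: n intro!: induced_act_closed GL_inv_closed \<phi>(1))
    also have "gl_fourier induced_scale n \<psi> (\<lambda>g. induced_act \<rho>s (inv\<^bsub>GL n\<^esub> g) \<phi>) a = 0"
      using gl_fourier_induced_act[OF \<psi> \<phi>(1) van] a unfolding n by blast
    \<comment> \<open>This is linearity for the empty sum.\<close>
    also have "F 0 = 0"
      using linear_on_sum[OF vector_space_induced_scale subspace_induced_space lin, of "{}"] by simp
    finally show "gl_fourier s n \<psi> (\<lambda>g. \<pi> (inv\<^bsub>GL n\<^esub> g) v) a = 0" .
  qed
qed

theorem theorem4p8:
  fixes sqrt_q :: "'r::alg_closed_field"
    and n :: nat
    and scale :: "'r \<Rightarrow> 'v::ab_group_add \<Rightarrow> 'v"
    and \<pi> :: "'k::{field,finite} mat \<Rightarrow> 'v \<Rightarrow> 'v"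
  assumes "CHAR('r) \<noteq> CHAR('k)"
    and "sqrt_q\<^sup>2 = of_nat CARD('k)"
    and "irreducible_rep (GL n) scale UNIV \<pi>"
  shows "WGJFE sqrt_q n scale \<pi> \<and>
    ((\<exists>M. is_cuspidal_support n scale UNIV \<pi> M \<and> iso_class trivial_GL1 \<notin># M) \<or>
      (CHAR('r) \<noteq> 0 \<and> CHAR('r) dvd CARD('k) - 1)
     \<longrightarrow> GJFE sqrt_q n scale \<pi>)"
proof (intro conjI impI)
  show "WGJFE sqrt_q n scale \<pi>"
    by (rule irreducible_WGJFE[OF assms(3)])
  assume "(\<exists>M. is_cuspidal_support n scale UNIV \<pi> M \<and> iso_class trivial_GL1 \<notin># M) \<or>
    (CHAR('r) \<noteq> 0 \<and> CHAR('r) dvd CARD('k) - 1)"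
  then show "GJFE sqrt_q n scale \<pi>"
  proof
    assume "\<exists>M. is_cuspidal_support n scale UNIV \<pi> M \<and> iso_class trivial_GL1 \<notin># M"
    then show ?thesis
      using irreducible_GJFE[OF assms(3)] cuspidal_support_vanishes_on_singular by blast
  next
    assume "CHAR('r) \<noteq> 0 \<and> CHAR('r) dvd CARD('k) - 1"
    \<comment> \<open>Divisibility by the characteristic means that q - 1 is zero in the coefficient
      field.\<close>
    then have "of_nat (CARD('k) - 1) = (0::'r)"
      by (simp only: of_nat_eq_0_iff_char_dvd)
    from irreducible_vanishes_on_singular[OF this _ assms(3)] show ?thesis
      by (rule irreducible_GJFE[OF assms(3)])
  qed
qed

end
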